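(* Let $n=2$ and $m_1=m_2=m$, and let $k=k(m)\ge 1$ be an integer. If $k=o(m^{2/3})$, then as $m\to\infty$ $$\Pr\left[\text{the clockwork best-response dynamic on } G_{2,(m,m)} \text{ converges to a } 2k\text{-cycle}\right]\sim 2\sqrt{\frac{\pi}{m}}\left(1-\Phi\left(\frac{2k-1}{\sqrt{2m}}\right)\right).$$ If $k=o(\sqrt{m})$, then as $m\to\infty$ this probability is asymptotically $\sqrt{\pi/m}$.
   Context: A random 2-player game $G_{2,(m,m)}$: each player $i\in\{1,2\}$ has actions $[m]=\{1,\dots,m\}$; payoffs $U_i(\mathbf{a})$ for $\mathbf{a}\in[m]^2$ are drawn independently from a fixed atomless distribution on $\mathbb{R}$; the best response $B_i(a_{-i})=\arg\max_{x\in[m]}U_i(x,a_{-i})$ is a.s. unique. The clockwork sequence is $s_{\texttt{c}}(t)=1+((t-1)\bmod 2)$. The clockwork best-response dynamic: $\mathbf{A}^0$ uniform on $[m]^2$ independent of payoffs; for $t\ge 1$ with $i=s_{\texttt{c}}(t)$, $A^t_{-i}=A^{t-1}_{-i}$ and $A^t_i=B_i(A^{t-1}_{-i})$. The dynamic converges to a $2k$-cycle if $\inf\{\tau\ge 1:\mathbf{A}^\tau=\mathbf{A}^{\tau+2k}\text{ and }\mathbf{A}^\tau\ne\mathbf{A}^{\tau+2k'}\text{ for all }1\le k'<k\}$ is finite. $\Phi$ is the standard normal CDF. $f\sim g$ means $f/g\to1$; $f=o(g)$ means $f/g\to 0$ as $m\to\infty$. *)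

theory Defs
  imports "HOL-Probability.Probability" "HOL-Library.Landau_Symbols"
begin

text \<open>Payoff assignment: U (i, (a1, a2)) is the payoff U_i(a1,a2) of player i in {1,2}
  at profile (a1,a2) in [m]^2.  Profiles are pairs (a1, a2).\<close>

type_synonym payoffs = "nat \<times> (nat \<times> nat) \<Rightarrow> real"
type_synonym profile = "nat \<times> nat"

definition payoff_index :: "nat \<Rightarrow> (nat \<times> (nat \<times> nat)) set" where
  "payoff_index m = {1,2} \<times> ({1..m} \<times> {1..m})"

text \<open>Best responses (the argmax is a.s. unique).\<close>
definition best_resp1 :: "nat \<Rightarrow> payoffs \<Rightarrow> nat \<Rightarrow> nat" where
  "best_resp1 m U a2 = arg_max_on (\<lambda>x. U (1, (x, a2))) {1..m}"

definition best_resp2 :: "nat \<Rightarrow> payoffs \<Rightarrow> nat \<Rightarrow> nat" where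
  "best_resp2 m U a1 = arg_max_on (\<lambda>x. U (2, (a1, x))) {1..m}"

definition clockwork :: "nat \<Rightarrow> nat" where
  "clockwork t = 1 + ((t - 1) mod 2)"

fun cw_dyn :: "nat \<Rightarrow> payoffs \<Rightarrow> profile \<Rightarrow> nat \<Rightarrow> profile" where
  "cw_dyn m U a0 0 = a0"
| "cw_dyn m U a0 (Suc t) =
     (let A = cw_dyn m U a0 t in
      if clockwork (Suc t) = 1 then (best_resp1 m U (snd A), snd A)
      else (fst A, best_resp2 m U (fst A)))"

definition converges_to_cycle :: "nat \<Rightarrow> payoffs \<Rightarrow> profile \<Rightarrow> nat \<Rightarrow> bool" where
  "converges_to_cycle m U a0 k \<longleftrightarrow>
     (\<exists>\<tau>\<ge>1. cw_dyn m U a0 \<tau> = cw_dyn m U a0 (\<tau> + 2*k) \<and>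
        (\<forall>k'. 1 \<le> k' \<and> k' < k \<longrightarrow> cw_dyn m U a0 \<tau> \<noteq> cw_dyn m U a0 (\<tau> + 2*k')))"

definition game_space :: "real measure \<Rightarrow> nat \<Rightarrow> (payoffs \<times> profile) measure" where
  "game_space D m =
     pair_measure (PiM (payoff_index m) (\<lambda>_. D)) (uniform_count_measure ({1..m} \<times> {1..m}))"

definition cycle_prob :: "real measure \<Rightarrow> nat \<Rightarrow> nat \<Rightarrow> real" where
  "cycle_prob D m k =
     measure (game_space D m)
       {\<omega> \<in> space (game_space D m). converges_to_cycle m (fst \<omega>) (snd \<omega>) k}"

definition Phi :: "real \<Rightarrow> real" where
  "Phi x = measure (density lborel std_normal_density) {..x}"

end

theory Submission
  imports Defs "HOL-Real_Asymp.Real_Asymp"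
begin

text \<open>Because the payoff distribution is atomless, ties have probability zero, and by symmetry
  under permuting the payoffs the best responses to the \<open>2 * m\<close> opponent actions are independent
  and uniform. The dynamic is therefore the orbit of a random map on a bipartite set of \<open>2 * m\<close>
  nodes, and it reaches a \<open>2k\<close>-cycle iff at the time \<open>T\<close> of its first repetition it jumps back by
  exactly \<open>2 * k\<close> steps. Summing over \<open>T\<close> gives the exact birthday-type formula
  \<open>(\<Sum>T=2k..2m. \<Prod>j<T. 1 - \<lfloor>j/2\<rfloor>/m) / m\<close>. The product is \<open>exp (- (T-1)\<^sup>2 / (4 m) + O(T\<^sup>3 / m\<^sup>2))\<close>,
  and only the \<open>T\<close> within \<open>m powr (3/5)\<close> of \<open>2k\<close> matter, so for \<open>k = o(m powr (2/3))\<close> the sum is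
  asymptotic to a Gaussian tail integral.\<close>

section \<open>The normal distribution function\<close>

text \<open>For \<open>k\<close> far above \<open>sqrt m\<close> the probability is of smaller order
  than \<open>1 / sqrt m\<close>, so additive errors are useless: every estimate has to be a factor
  times the Gaussian tail itself. The upper bound needs no truncation, because
  \<open>1 - x <= exp (- x)\<close> holds everywhere; apart from a factor
  \<open>exp (1 / (4 * m))\<close>, its loss is the first term of the sum, which is charged to a
  stretch of the Gaussian integral of length \<open>d = m powr (1/3)\<close>. This length tends to
  infinity, while the density changes along it by a factor that stays bounded if
  \<open>k * d / m\<close> does, and \<open>k = o(m powr (2/3))\<close> even makes that quotient
  vanish. The lower bound keeps a window of length about \<open>m powr (3/5)\<close>: long compared
  with \<open>sqrt m\<close>, so that the tail beyond it is a negligible fraction, and short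
  compared with \<open>m powr (2/3)\<close>, so that the cubic error vanishes. Any exponent strictly
  between 1/2 and 2/3 would serve.\<close>

abbreviation "std_normal_measure \<equiv> density lborel (\<lambda>x. ennreal (std_normal_density x))"

lemma prob_space_std_normal_measure: "prob_space std_normal_measure"
  by (rule prob_space_normal_density) simp

lemma one_minus_Phi_eq: "1 - Phi x = measure std_normal_measure {x<..}"
proof -
  interpret prob_space std_normal_measure by (rule prob_space_std_normal_measure)
  have "prob (space std_normal_measure - {..x}) = 1 - prob {..x}" by (rule prob_compl) simp
  moreover have "space std_normal_measure - {..x} = {x<..}" by auto
  ultimately show ?thesis by (simp add: Phi_def)
qed

lemma Phi_diff_eq:
  assumes "a \<le> b"
  shows "Phi b - Phi a = measure std_normal_measure {a<..b}"
proof -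
  interpret prob_space std_normal_measure by (rule prob_space_std_normal_measure)
  have "prob ({..b} - {..a}) = prob {..b} - prob {..a}"
    using assms by (intro finite_measure_Diff) auto
  moreover have "{..b} - {..a} = {a<..b}" by auto
  ultimately show ?thesis by (simp add: Phi_def)
qed

lemma std_normal_density_antimono:
  assumes "0 \<le> a" "a \<le> b"
  shows "std_normal_density b \<le> std_normal_density a"
  unfolding std_normal_density_def using assms by (intro mult_left_mono) (auto intro: power_mono)

lemma Phi_diff_le:
  assumes "0 \<le> a" "a \<le> b"
  shows "Phi b - Phi a \<le> (b - a) * std_normal_density a"
proof -
  interpret prob_space std_normal_measure by (rule prob_space_std_normal_measure)
  have "emeasure std_normal_measure {a<..b} =
      (\<integral>\<^sup>+x. ennreal (std_normal_density x) * indicator {a<..b} x \<partial>lborel)"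
    by (subst emeasure_density) auto
  also have "\<dots> \<le> (\<integral>\<^sup>+x. ennreal (std_normal_density a) * indicator {a<..b} x \<partial>lborel)"
    using assms by (intro nn_integral_mono) (auto split: split_indicator intro!: ennreal_leI std_normal_density_antimono)
  also have "\<dots> = ennreal ((b - a) * std_normal_density a)"
    using assms by (subst nn_integral_cmult_indicator) (auto simp: ennreal_mult mult.commute)
  finally have "ennreal (measure std_normal_measure {a<..b}) \<le> ennreal ((b - a) * std_normal_density a)"
    by (simp add: emeasure_eq_measure)
  thus ?thesis using assms by (simp add: Phi_diff_eq)
qed

lemma Phi_diff_ge:
  assumes "0 \<le> a" "a \<le> b"
  shows "(b - a) * std_normal_density b \<le> Phi b - Phi a"
proof -
  interpret prob_space std_normal_measure by (rule prob_space_std_normal_measure)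
  have "ennreal ((b - a) * std_normal_density b) =
      (\<integral>\<^sup>+x. ennreal (std_normal_density b) * indicator {a<..b} x \<partial>lborel)"
    using assms by (subst nn_integral_cmult_indicator) (auto simp: ennreal_mult mult.commute)
  also have "\<dots> \<le> (\<integral>\<^sup>+x. ennreal (std_normal_density x) * indicator {a<..b} x \<partial>lborel)"
    using assms by (intro nn_integral_mono) (auto split: split_indicator intro!: ennreal_leI std_normal_density_antimono)
  also have "\<dots> = emeasure std_normal_measure {a<..b}"
    by (subst emeasure_density) auto
  finally have "ennreal ((b - a) * std_normal_density b) \<le> ennreal (measure std_normal_measure {a<..b})"
    by (simp add: emeasure_eq_measure)
  thus ?thesis using assms by (simp add: Phi_diff_eq)
qed

lemma Phi_le_1: "Phi x \<le> 1"
  using one_minus_Phi_eq[of x] measure_nonneg[of std_normal_measure "{x<..}"] by linarith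

lemma Phi_less_1:
  assumes "0 \<le> x"
  shows "Phi x < 1"
proof -
  have "0 < (x + 1 - x) * std_normal_density (x + 1)" by (simp add: normal_density_pos)
  also have "\<dots> \<le> Phi (x + 1) - Phi x" using assms by (intro Phi_diff_ge) auto
  also have "\<dots> \<le> 1 - Phi x" using Phi_le_1 by simp
  finally show ?thesis by simp
qed

text \<open>Translate the tail by \<open>d\<close> and use that (d + x)^2 is at least d^2 + x^2 for
  nonnegative \<open>d\<close> and \<open>x\<close>. The bound is relative to the tail at
  \<open>y\<close>, so it stays useful when that tail itself tends to 0.\<close>

lemma one_minus_Phi_shift_le:
  assumes "0 \<le> y" "0 \<le> d"
  shows "1 - Phi (y + d) \<le> exp (- (d\<^sup>2) / 2) * (1 - Phi y)"
proof -
  interpret prob_space std_normal_measure by (rule prob_space_std_normal_measure)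
  have shift: "std_normal_density (d + x) \<le> exp (- (d\<^sup>2) / 2) * std_normal_density x" if "y < x" for x
  proof -
    have "- (d + x)\<^sup>2 / 2 \<le> - (d\<^sup>2) / 2 + - x\<^sup>2 / 2"
      using assms that by (simp add: power2_sum)
    hence "exp (- (d + x)\<^sup>2 / 2) \<le> exp (- (d\<^sup>2) / 2 + - x\<^sup>2 / 2)"
      by (rule exp_le_cancel_iff[THEN iffD2])
    hence "exp (- (d + x)\<^sup>2 / 2) \<le> exp (- (d\<^sup>2) / 2) * exp (- x\<^sup>2 / 2)"
      by (simp only: exp_add)
    hence "1 / sqrt (2 * pi) * exp (- (d + x)\<^sup>2 / 2)
        \<le> 1 / sqrt (2 * pi) * (exp (- (d\<^sup>2) / 2) * exp (- x\<^sup>2 / 2))"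
      by (rule mult_left_mono) simp
    thus ?thesis unfolding std_normal_density_def by (simp only: mult.left_commute)
  qed
  have "emeasure std_normal_measure {y+d<..} =
      (\<integral>\<^sup>+x. ennreal (std_normal_density x) * indicator {y+d<..} x \<partial>lborel)"
    by (subst emeasure_density) auto
  also have "\<dots> = (\<integral>\<^sup>+x. ennreal (std_normal_density (d + x)) * indicator {y+d<..} (d + x) \<partial>lborel)"
    using nn_integral_real_affine[of "\<lambda>x. ennreal (std_normal_density x) * indicator {y+d<..} x" 1 d] by simp
  also have "\<dots> \<le> (\<integral>\<^sup>+x. ennreal (exp (- (d\<^sup>2) / 2)) * (ennreal (std_normal_density x) * indicator {y<..} x) \<partial>lborel)"
    using shift by (intro nn_integral_mono) (auto split: split_indicator simp flip: ennreal_mult)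
  also have "\<dots> = ennreal (exp (- (d\<^sup>2) / 2)) * emeasure std_normal_measure {y<..}"
    by (subst nn_integral_cmult) (auto simp: emeasure_density)
  finally have "ennreal (measure std_normal_measure {y+d<..})
      \<le> ennreal (exp (- (d\<^sup>2) / 2) * measure std_normal_measure {y<..})"
    by (simp add: emeasure_eq_measure ennreal_mult)
  thus ?thesis by (simp add: one_minus_Phi_eq)
qed

lemma Phi_0: "Phi 0 = 1 / 2"
proof -
  interpret prob_space std_normal_measure by (rule prob_space_std_normal_measure)
  have "emeasure std_normal_measure {..0} =
      (\<integral>\<^sup>+x. ennreal (std_normal_density x) * indicator {..0} x \<partial>lborel)"
    by (subst emeasure_density) auto
  also have "\<dots> = (\<integral>\<^sup>+x. ennreal (std_normal_density (-x)) * indicator {..0} (-x) \<partial>lborel)"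
    using nn_integral_real_affine[of "\<lambda>x. ennreal (std_normal_density x) * indicator {..0} x" "-1" 0] by simp
  \<comment> \<open>Reflection sends the half-line to a closed one; the endpoint 0 is a null
    set.\<close>
  also have "\<dots> = (\<integral>\<^sup>+x. ennreal (std_normal_density x) * indicator {0<..} x \<partial>lborel)"
  proof (rule nn_integral_cong_AE)
    show "AE x in lborel. ennreal (std_normal_density (-x)) * indicator {..0} (-x) =
        ennreal (std_normal_density x) * indicator {0<..} x"
      using AE_lborel_singleton[of 0]
      by eventually_elim (auto split: split_indicator simp: std_normal_density_def)
  qed
  also have "\<dots> = emeasure std_normal_measure {0<..}"
    by (subst emeasure_density) auto
  finally have "measure std_normal_measure {..0} = measure std_normal_measure {0<..}"
    by (simp add: measure_def)
  thus ?thesis using one_minus_Phi_eq[of 0] by (simp add: Phi_def)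
qed

section \<open>Orbits and alternating paths\<close>

text \<open>An orbit that ever repeats is rho-shaped: a tail of length \<open>i\<close>, then a
  cycle of length \<open>q\<close>, where \<open>i + q\<close> is the time of the first repetition.
  Any point that returns at all lies on the cycle, so its least return time is \<open>q\<close>. No
  finiteness is assumed; the repetition comes from the left-hand side.\<close>

lemma funpow_orbit_first_return:
  fixes G :: "'a \<Rightarrow> 'a" and z0 :: 'a
  defines "z \<equiv> \<lambda>t. (G ^^ t) z0"
  assumes "p \<ge> 1"
  shows "(\<exists>s. z s = z (s + p) \<and> (\<forall>p'. 1 \<le> p' \<and> p' < p \<longrightarrow> z s \<noteq> z (s + p'))) \<longleftrightarrow>
         (\<exists>T\<ge>p. inj_on z {..<T} \<and> z T = z (T - p))" (is "?L \<longleftrightarrow> ?R")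
proof
  assume ?R
  then obtain T where T: "T \<ge> p" "inj_on z {..<T}" "z T = z (T - p)" by blast
  show ?L
  proof (intro exI[of _ "T - p"] conjI allI impI)
    show "z (T - p) = z (T - p + p)" using T by simp
    fix p' assume "1 \<le> p' \<and> p' < p"
    thus "z (T - p) \<noteq> z (T - p + p')"
      using T(1) inj_onD[OF T(2), of "T - p" "T - p + p'"] by fastforce
  qed
next
  have shift: "z (i + n) = z (j + n)" if "z i = z j" for i j n
    using that by (simp add: z_def add.commute[of _ n] funpow_add)
  have mult: "z (i + n * q) = z i" if "z i = z (i + q)" for i q n
  proof (induction n)
    case (Suc n)
    have "z (i + Suc n * q) = z (i + n * q + q)" by (simp add: algebra_simps)
    also have "\<dots> = z (i + q)" using shift[OF Suc] by simp
    finally show ?case using that by simp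
  qed simp
  assume ?L
  then obtain s where s: "z s = z (s + p)"
    and smin: "\<And>p'. 1 \<le> p' \<Longrightarrow> p' < p \<Longrightarrow> z s \<noteq> z (s + p')" by blast
  define T where "T = (LEAST T. \<exists>i<T. z T = z i)"
  have "\<exists>T. \<exists>i<T. z T = z i" using s \<open>p \<ge> 1\<close> by (intro exI[of _ "s + p"] exI[of _ s]) auto
  hence "\<exists>i<T. z T = z i" unfolding T_def by (rule LeastI_ex)
  then obtain i where i: "i < T" "z T = z i" by blast
  have "z a \<noteq> z b" if "b < a" "a < T" for a b
    using not_less_Least[of a "\<lambda>T. \<exists>i<T. z T = z i"] that unfolding T_def by blast
  hence inj: "inj_on z {..<T}" by (intro linorder_inj_onI) (auto, metis)
  define q where "q = T - i"
  have q: "q \<ge> 1" "z i = z (i + q)" using i by (auto simp: q_def)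
  \<comment> \<open>Running \<open>i\<close> times around the \<open>p\<close>-cycle returns to
    \<open>z s\<close> at a time past \<open>i\<close>, where \<open>q\<close> is known to be a
    period. Hence \<open>q\<close> is a period at \<open>s\<close>, and minimality of
    \<open>p\<close> gives \<open>p <= q\<close>.\<close>
  define u where "u = s + i * p"
  have zu: "z u = z s" unfolding u_def by (rule mult[OF s])
  have "i \<le> u" using \<open>p \<ge> 1\<close> by (simp add: u_def trans_le_add2)
  hence "z u = z (u + q)" using shift[OF q(2), of "u - i"] by (simp add: add.commute)
  hence "z s = z (s + q)" using zu shift[OF zu, of q] by simp
  hence "p \<le> q" using smin[of q] q by force
  moreover have "\<not> p < q"
  proof
    \<comment> \<open>The same trick with the roles exchanged: \<open>s\<close> rounds of length
      \<open>q\<close> started at \<open>i\<close> end past \<open>s\<close>, where \<open>p\<close>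
      is a period. So \<open>z i\<close> recurs at \<open>i + p\<close>, which lies before
      \<open>T\<close>.\<close>
    assume "p < q"
    have "z (s + (i + s * q - s)) = z (s + p + (i + s * q - s))" by (rule shift[OF s])
    moreover have "s \<le> i + s * q" using q(1) by (simp add: trans_le_add2)
    ultimately have "z (i + s * q) = z (i + s * q + p)" by (simp add: add.commute add.left_commute)
    also have "\<dots> = z (i + p)" by (rule shift[OF mult[OF q(2)]])
    finally have "z i = z (i + p)" using mult[OF q(2)] by simp
    thus False using inj_onD[OF inj, of i "i + p"] \<open>p < q\<close> \<open>p \<ge> 1\<close> by (auto simp: q_def less_diff_conv)
  qed
  ultimately have "p = q" by simp
  thus ?R using inj i by (intro exI[of _ T]) (auto simp: q_def)
qed

text \<open>Entry \<open>j\<close> is the action to which the player moving at step \<open>j\<close>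
  responds. The parity of the position identifies that player, so only entries of equal parity have
  to differ for the nodes to be distinct.\<close>

definition alt_paths :: "nat \<Rightarrow> nat \<Rightarrow> nat list set" where
  "alt_paths m T = {ys. length ys = T \<and> set ys \<subseteq> {1..m} \<and>
     (\<forall>i<T. \<forall>j<T. even (i + j) \<and> ys ! i = ys ! j \<longrightarrow> i = j)}"

lemma finite_alt_paths: "finite (alt_paths m T)"
  by (rule finite_subset[OF _ finite_lists_length_eq[of "{1..m}" T]]) (auto simp: alt_paths_def)

lemma card_same_parity_below: "card {i. i < T \<and> even (i + T)} = T div 2"
proof (induction T rule: induct_nat_012)
  case (ge2 T)
  have "{i. i < Suc (Suc T) \<and> even (i + Suc (Suc T))} = insert T {i. i < T \<and> even (i + T)}"
    by (auto simp: less_Suc_eq)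
  thus ?case using ge2 by (simp del: add_Suc_right)
qed (auto intro: odd_pos)

text \<open>A new entry at position \<open>T\<close> must avoid the \<open>T div 2\<close> distinct
  values at earlier positions of the same parity. Beyond length \<open>2 * m\<close> the factor for
  \<open>j = 2 * m\<close> is 0, in accordance with there being no such path.\<close>

lemma card_alt_paths: "card (alt_paths m T) = (\<Prod>j<T. m - j div 2)"
proof (induction T)
  case 0
  have "alt_paths m 0 = {[]}" by (auto simp: alt_paths_def)
  thus ?case by simp
next
  case (Suc T)
  define used where "used ys = (!) ys ` {i. i < T \<and> even (i + T)}" for ys :: "nat list"
  have eq: "alt_paths m (Suc T) = (\<lambda>(ys, a). ys @ [a]) ` (SIGMA ys:alt_paths m T. {1..m} - used ys)"
  proof (intro equalityI subsetI)
    fix ys assume ys: "ys \<in> alt_paths m (Suc T)"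
    then obtain zs a where zs: "ys = zs @ [a]" "length zs = T"
      unfolding alt_paths_def by (cases ys rule: rev_cases) auto
    have nth: "ys ! i = zs ! i" if "i < T" for i using that zs by (simp add: nth_append)
    have last: "ys ! T = a" using zs by (simp add: nth_append)
    have *: "\<And>i j. i < Suc T \<Longrightarrow> j < Suc T \<Longrightarrow> even (i + j) \<Longrightarrow> ys ! i = ys ! j \<Longrightarrow> i = j"
      using ys unfolding alt_paths_def by blast
    have "zs \<in> alt_paths m T"
      unfolding alt_paths_def mem_Collect_eq
    proof (intro conjI allI impI)
      show "length zs = T" "set zs \<subseteq> {1..m}" using ys zs by (auto simp: alt_paths_def)
      fix i j assume "i < T" "j < T" "even (i + j) \<and> zs ! i = zs ! j"
      thus "i = j" using *[of i j] by (simp add: nth)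
    qed
    moreover have "a \<notin> used zs"
    proof
      assume "a \<in> used zs"
      then obtain i where "i < T" "even (i + T)" "a = zs ! i" unfolding used_def by blast
      thus False using *[of i T] nth[of i] last by simp
    qed
    moreover have "a \<in> {1..m}" using ys zs by (auto simp: alt_paths_def)
    ultimately show "ys \<in> (\<lambda>(ys, a). ys @ [a]) ` (SIGMA ys:alt_paths m T. {1..m} - used ys)"
      using zs by (auto intro!: image_eqI[of _ _ "(zs, a)"])
  next
    fix ys assume "ys \<in> (\<lambda>(ys, a). ys @ [a]) ` (SIGMA ys:alt_paths m T. {1..m} - used ys)"
    then obtain zs a where zs: "ys = zs @ [a]" "zs \<in> alt_paths m T" "a \<in> {1..m}" "a \<notin> used zs" by auto
    have len: "length zs = T" using zs by (simp add: alt_paths_def)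
    have *: "\<And>i j. i < T \<Longrightarrow> j < T \<Longrightarrow> even (i + j) \<Longrightarrow> zs ! i = zs ! j \<Longrightarrow> i = j"
      using zs unfolding alt_paths_def by blast
    have **: "\<And>i. i < T \<Longrightarrow> even (i + T) \<Longrightarrow> zs ! i \<noteq> a"
      using zs(4) by (auto simp: used_def)
    have "i = j" if ij: "i < Suc T" "j < Suc T" "even (i + j)" "ys ! i = ys ! j" for i j
    proof -
      consider "i < T" "j < T" | "i < T" "j = T" | "i = T" "j < T" | "i = T" "j = T"
        using ij unfolding less_Suc_eq by blast
      thus ?thesis
        using ij(3,4) *[of i j] **[of i] **[of j] len
        by cases (auto simp: zs(1) nth_append add.commute)
    qed
    thus "ys \<in> alt_paths m (Suc T)"
      using zs len by (auto simp: alt_paths_def)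
  qed
  have card_used: "card ({1..m} - used ys) = m - T div 2" if "ys \<in> alt_paths m T" for ys
  proof -
    have *: "\<And>i j. i < T \<Longrightarrow> j < T \<Longrightarrow> even (i + j) \<Longrightarrow> ys ! i = ys ! j \<Longrightarrow> i = j"
      using that unfolding alt_paths_def by blast
    have "inj_on ((!) ys) {i. i < T \<and> even (i + T)}"
      by (rule inj_onI, rule *) auto
    hence "card (used ys) = T div 2"
      unfolding used_def by (simp only: card_image card_same_parity_below)
    moreover have "used ys \<subseteq> {1..m}"
      using that unfolding used_def alt_paths_def by (auto simp: subset_iff)
    ultimately show ?thesis by (subst card_Diff_subset) (auto simp: used_def)
  qed
  have "card (alt_paths m (Suc T)) = card (SIGMA ys:alt_paths m T. {1..m} - used ys)"
    unfolding eq by (intro card_image inj_onI) auto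
  also have "\<dots> = (\<Sum>ys\<in>alt_paths m T. card ({1..m} - used ys))"
    by (intro card_SigmaI finite_alt_paths) auto
  also have "\<dots> = card (alt_paths m T) * (m - T div 2)" using card_used by simp
  finally show ?case using Suc by simp
qed

section \<open>Joint distribution of the best responses\<close>

lemma arg_max_on_props:
  fixes f :: "'a \<Rightarrow> real"
  assumes "finite X" "X \<noteq> {}"
  shows "arg_max_on f X \<in> X" "\<And>x. x \<in> X \<Longrightarrow> f x \<le> f (arg_max_on f X)"
proof -
  have "Max (f ` X) \<in> f ` X" using assms by (intro Max_in) auto
  then obtain b where "b \<in> X" "f b = Max (f ` X)" by auto
  hence "is_arg_max f (\<lambda>x. x \<in> X) b"
    using assms by (auto simp: is_arg_max_linorder)
  hence "is_arg_max f (\<lambda>x. x \<in> X) (arg_max_on f X)"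
    unfolding arg_max_on_def arg_max_def by (rule someI)
  thus "arg_max_on f X \<in> X" "\<And>x. x \<in> X \<Longrightarrow> f x \<le> f (arg_max_on f X)"
    by (auto simp: is_arg_max_linorder)
qed

lemma arg_max_on_eq_iff:
  fixes f :: "'a \<Rightarrow> real"
  assumes "finite X" "inj_on f X" "b \<in> X"
  shows "arg_max_on f X = b \<longleftrightarrow> (\<forall>x\<in>X. f x \<le> f b)"
proof -
  have "X \<noteq> {}" using assms by auto
  note * = arg_max_on_props[where f = f, OF assms(1) this]
  show ?thesis
    using * assms(2,3) by (meson inj_onD order_antisym)
qed

text \<open>Permuting the arguments moves the maximiser along. Injectivity matters: at a tie the
  arbitrary choice inside \<open>arg_max_on\<close> need not commute with \<open>g\<close>.\<close>

lemma arg_max_on_reindex_iff: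
  fixes f :: "'a \<Rightarrow> real"
  assumes "finite X" "inj_on f X" "b \<in> X" "bij_betw g X X"
  shows "arg_max_on (\<lambda>x. f (g x)) X = b \<longleftrightarrow> arg_max_on f X = g b"
proof -
  have "inj_on (f \<circ> g) X"
    using assms by (intro comp_inj_on) (auto simp: bij_betw_def)
  hence "arg_max_on (\<lambda>x. f (g x)) X = b \<longleftrightarrow> (\<forall>x\<in>X. f (g x) \<le> f (g b))"
    using assms by (intro arg_max_on_eq_iff) (auto simp: o_def)
  also have "\<dots> \<longleftrightarrow> (\<forall>x\<in>g ` X. f x \<le> f (g b))" by auto
  also have "g ` X = X" using assms(4) by (simp add: bij_betw_def)
  also have "(\<forall>x\<in>X. f x \<le> f (g b)) \<longleftrightarrow> arg_max_on f X = g b"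
    using assms by (intro arg_max_on_eq_iff[symmetric]) (auto simp: bij_betw_def)
  finally show ?thesis .
qed

text \<open>With ties, \<open>arg_max_on\<close> is an arbitrary but fixed choice from the set of
  maximisers. That set takes finitely many values and is measurable as a random element of a
  discrete space, where every further function is measurable.\<close>

lemma measurable_arg_max_on:
  fixes F :: "'a \<Rightarrow> 'b \<Rightarrow> real"
  assumes "finite X" and "\<And>x. x \<in> X \<Longrightarrow> (\<lambda>\<omega>. F \<omega> x) \<in> borel_measurable M"
  shows "(\<lambda>\<omega>. arg_max_on (F \<omega>) X) \<in> M \<rightarrow>\<^sub>M count_space UNIV"
proof -
  define maxset where "maxset \<omega> = {x\<in>X. \<forall>y\<in>X. F \<omega> y \<le> F \<omega> x}" for \<omega>
  have "maxset \<in> M \<rightarrow>\<^sub>M count_space (Pow X)"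
  proof (subst measurable_count_space_eq2)
    have "maxset -` {A} \<inter> space M \<in> sets M" if "A \<subseteq> X" for A
    proof -
      have "{x\<in>X. P x} = A \<longleftrightarrow> (\<forall>x\<in>X. P x \<longleftrightarrow> x \<in> A)" for P
        using that by blast
      hence "maxset \<omega> = A \<longleftrightarrow> (\<forall>x\<in>X. (\<forall>y\<in>X. F \<omega> y \<le> F \<omega> x) \<longleftrightarrow> x \<in> A)" for \<omega>
        unfolding maxset_def .
      hence "maxset -` {A} \<inter> space M = {\<omega>\<in>space M. \<forall>x\<in>X. (\<forall>y\<in>X. F \<omega> y \<le> F \<omega> x) \<longleftrightarrow> x \<in> A}"
        by (simp only: set_eq_iff vimage_singleton_eq Int_iff mem_Collect_eq conj_commute simp_thms)
      also have "\<dots> \<in> sets M"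
      proof (rule sets.sets_Collect_finite_All)
        fix x assume "x \<in> X"
        hence "{\<omega>\<in>space M. \<forall>y\<in>X. F \<omega> y \<le> F \<omega> x} \<in> sets M"
          using assms by (intro sets.sets_Collect_finite_All borel_measurable_le) auto
        thus "{\<omega>\<in>space M. (\<forall>y\<in>X. F \<omega> y \<le> F \<omega> x) \<longleftrightarrow> x \<in> A} \<in> sets M"
          by (cases "x \<in> A") (simp_all only: simp_thms sets.sets_Collect_neg)
      qed fact
      finally show ?thesis .
    qed
    thus "maxset \<in> space M \<rightarrow> Pow X \<and> (\<forall>A\<in>Pow X. maxset -` {A} \<inter> space M \<in> sets M)"
      by (auto simp: maxset_def)
  qed (use \<open>finite X\<close> in auto)
  hence "(\<lambda>\<omega>. SOME x. x \<in> maxset \<omega>) \<in> M \<rightarrow>\<^sub>M count_space UNIV"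
    by (rule measurable_compose) simp
  thus ?thesis
    by (simp add: arg_max_on_def arg_max_def is_arg_max_linorder maxset_def Ball_def)
qed

text \<open>Fubini: with all coordinates other than \<open>p\<close> frozen, a tie forces coordinate
  \<open>p\<close> into the single point \<open>V q\<close>, which is null for an atomless
  law.\<close>

lemma AE_PiM_components_neq:
  fixes D :: "real measure"
  assumes "prob_space D" "sets D = sets borel" "\<And>x. measure D {x} = 0"
    and "finite I" "p \<in> I" "q \<in> I" "p \<noteq> q"
  shows "AE U in PiM I (\<lambda>_. D). U p \<noteq> U q"
proof -
  interpret D: prob_space D by fact
  interpret product_sigma_finite "\<lambda>_. D" by unfold_locales
  have [measurable_cong]: "sets D = sets borel" by fact
  define J where "J = I - {p}"
  have J: "I = insert p J" "p \<notin> J" "finite J" "q \<in> J" using assms by (auto simp: J_def)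
  have *: "(\<lambda>U. U i) \<in> borel_measurable (PiM (insert p J) (\<lambda>_. D))" if "i \<in> insert p J" for i
    using measurable_component_singleton[OF that, of "\<lambda>_. D"] assms(2)
    by (simp cong: measurable_cong_sets)
  have [measurable]: "(\<lambda>U. U p) \<in> borel_measurable (PiM (insert p J) (\<lambda>_. D))"
    "(\<lambda>U. U q) \<in> borel_measurable (PiM (insert p J) (\<lambda>_. D))"
    using * J by auto
  define A where "A = {U\<in>space (PiM (insert p J) (\<lambda>_. D)). U p = U q}"
  have A: "A \<in> sets (PiM (insert p J) (\<lambda>_. D))" unfolding A_def by measurable
  have sp: "space D = UNIV" using sets_eq_imp_space_eq[OF assms(2)] by simp
  have "emeasure (PiM (insert p J) (\<lambda>_. D)) A
      = (\<integral>\<^sup>+U. indicator A U \<partial>PiM (insert p J) (\<lambda>_. D))"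
    using A by simp
  also have "\<dots> = (\<integral>\<^sup>+V. (\<integral>\<^sup>+y. indicator A (V(p := y)) \<partial>D) \<partial>PiM J (\<lambda>_. D))"
    using A J by (intro product_nn_integral_insert) auto
  also have "\<dots> = (\<integral>\<^sup>+V. 0 \<partial>PiM J (\<lambda>_. D))"
  proof (rule nn_integral_cong)
    fix V assume "V \<in> space (PiM J (\<lambda>_. D))"
    hence "(\<integral>\<^sup>+y. indicator A (V(p := y)) \<partial>D) = (\<integral>\<^sup>+y. indicator {V q} y \<partial>D)"
      using J sp by (intro nn_integral_cong)
        (auto simp: A_def space_PiM PiE_iff extensional_def split: split_indicator)
    also have "\<dots> = emeasure D {V q}" using assms(2) by simp
    also have "\<dots> = 0" using assms(3) by (simp add: D.emeasure_eq_measure)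
    finally show "(\<integral>\<^sup>+y. indicator A (V(p := y)) \<partial>D) = 0" .
  qed
  finally have "emeasure (PiM (insert p J) (\<lambda>_. D)) A = 0" by simp
  hence "A \<in> null_sets (PiM (insert p J) (\<lambda>_. D))" using A by auto
  thus ?thesis unfolding J(1) by (rule AE_I') (auto simp: A_def)
qed

text \<open>A node \<open>(i, a)\<close> stands for player \<open>i\<close> responding to action \<open>a\<close> of the opponent.\<close>

definition resp_cell :: "nat \<times> nat \<Rightarrow> nat \<Rightarrow> nat \<times> (nat \<times> nat)" where
  "resp_cell v x = (fst v, if fst v = 1 then (x, snd v) else (snd v, x))"

text \<open>Together with \<open>resp_action\<close> this inverts \<open>resp_cell\<close>: the
  payoff cells split into disjoint rows, one for each node, so a permutation can act inside every
  row separately.\<close>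

definition resp_node :: "nat \<times> (nat \<times> nat) \<Rightarrow> nat \<times> nat" where
  "resp_node p = (fst p, if fst p = 1 then snd (snd p) else fst (snd p))"

definition resp_action :: "nat \<times> (nat \<times> nat) \<Rightarrow> nat" where
  "resp_action p = (if fst p = 1 then fst (snd p) else snd (snd p))"

definition best_resp :: "nat \<Rightarrow> payoffs \<Rightarrow> nat \<times> nat \<Rightarrow> nat" where
  "best_resp m U v = arg_max_on (\<lambda>x. U (resp_cell v x)) {1..m}"

lemma resp_cell_simps [simp]:
  "resp_node (resp_cell v x) = v" "resp_action (resp_cell v x) = x"
  "resp_cell (resp_node p) (resp_action p) = p"
  by (cases v; cases p; simp add: resp_node_def resp_action_def resp_cell_def)+

lemma resp_cell_eq_iff [simp]: "resp_cell v x = resp_cell w y \<longleftrightarrow> v = w \<and> x = y"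
  by (metis resp_cell_simps)

lemma resp_cell_in_payoff_index:
  "v \<in> {1,2} \<times> {1..m} \<Longrightarrow> x \<in> {1..m} \<Longrightarrow> resp_cell v x \<in> payoff_index m"
  by (auto simp: payoff_index_def resp_cell_def)

lemma payoff_index_cases:
  assumes "p \<in> payoff_index m"
  obtains v x where "p = resp_cell v x" "v \<in> {1,2} \<times> {1..m}" "x \<in> {1..m}"
proof (rule that[of "resp_node p" "resp_action p"])
  show "p = resp_cell (resp_node p) (resp_action p)" by simp
  show "resp_node p \<in> {1,2} \<times> {1..m}" "resp_action p \<in> {1..m}"
    using assms by (auto simp: payoff_index_def resp_node_def resp_action_def)
qed

lemma finite_payoff_index: "finite (payoff_index m)"
  by (simp add: payoff_index_def)

lemma best_resp_in: "m \<ge> 1 \<Longrightarrow> best_resp m U v \<in> {1..m}"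
  unfolding best_resp_def by (rule arg_max_on_props) auto

lemma measurable_best_resp:
  assumes "sets D = sets borel" "v \<in> {1,2} \<times> {1..m}"
  shows "(\<lambda>U. best_resp m U v) \<in> PiM (payoff_index m) (\<lambda>_. D) \<rightarrow>\<^sub>M count_space UNIV"
  unfolding best_resp_def
proof (rule measurable_arg_max_on)
  fix x assume "x \<in> {1..m}"
  hence "resp_cell v x \<in> payoff_index m" using assms resp_cell_in_payoff_index by blast
  from measurable_component_singleton[OF this, of "\<lambda>_. D"]
  show "(\<lambda>U. U (resp_cell v x)) \<in> borel_measurable (PiM (payoff_index m) (\<lambda>_. D))"
    using assms(1) by (simp cong: measurable_cong_sets)
qed simp

lemma AE_payoffs_inj:
  fixes D :: "real measure"
  assumes "prob_space D" "sets D = sets borel" "\<And>x. measure D {x} = 0"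
  shows "AE U in PiM (payoff_index m) (\<lambda>_. D). inj_on U (payoff_index m)"
proof -
  let ?I = "payoff_index m"
  have "AE U in PiM ?I (\<lambda>_. D). U (fst pq) \<noteq> U (snd pq)"
    if "pq \<in> {pq\<in>?I\<times>?I. fst pq \<noteq> snd pq}" for pq
    using that by (intro AE_PiM_components_neq assms finite_payoff_index) auto
  hence "AE U in PiM ?I (\<lambda>_. D). \<forall>pq\<in>{pq\<in>?I\<times>?I. fst pq \<noteq> snd pq}. U (fst pq) \<noteq> U (snd pq)"
    by (intro AE_finite_allI) (auto simp: finite_payoff_index)
  thus ?thesis
  proof eventually_elim
    case (elim U)
    show ?case
    proof (rule inj_onI, rule ccontr)
      fix p q assume "p \<in> ?I" "q \<in> ?I" "U p = U q" "p \<noteq> q"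
      thus False using bspec[OF elim, of "(p, q)"] by simp
    qed
  qed
qed

text \<open>Swap the actions \<open>h v\<close> and 1 inside the row of each node \<open>v\<close>
  of \<open>S\<close>. The payoffs are i.i.d., so this relabelling preserves their law, and off ties
  it carries one event to the other.\<close>

lemma prob_best_resp_eq_const:
  fixes D :: "real measure"
  assumes D: "prob_space D" "sets D = sets borel" "\<And>x. measure D {x} = 0"
    and "m \<ge> 1" and S: "S \<subseteq> {1,2} \<times> {1..m}" and h: "h \<in> S \<rightarrow> {1..m}"
  defines "M \<equiv> PiM (payoff_index m) (\<lambda>_. D)"
  shows "measure M {U\<in>space M. \<forall>v\<in>S. best_resp m U v = h v} =
         measure M {U\<in>space M. \<forall>v\<in>S. best_resp m U v = 1}"
proof -
  let ?I = "payoff_index m"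
  \<comment> \<open>All nodes are treated by one relabelling: a transposition in the rows of
    \<open>S\<close>, the identity in the others.\<close>
  define \<tau> where "\<tau> v = (if v \<in> S then Transposition.transpose (h v) 1 else id)" for v
  define \<pi> where "\<pi> p = resp_cell (resp_node p) (\<tau> (resp_node p) (resp_action p))" for p
  have \<pi>_cell: "\<pi> (resp_cell v x) = resp_cell v (\<tau> v x)" for v x by (simp add: \<pi>_def)
  have \<tau>_bij: "bij_betw (\<tau> v) {1..m} {1..m}" for v
  proof (cases "v \<in> S")
    case True
    hence "h v \<in> {1..m}" "1 \<in> {1..m}" using h \<open>m \<ge> 1\<close> by auto
    thus ?thesis using True by (simp add: \<tau>_def bij_betw_transpose_iff del: atLeastAtMost_iff)
  qed (auto simp: \<tau>_def)
  have \<tau>_in: "\<tau> v x \<in> {1..m}" if "x \<in> {1..m}" for v x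
    using \<tau>_bij[of v] that by (auto simp: bij_betw_def)
  have \<pi>_in: "\<pi> p \<in> ?I" if "p \<in> ?I" for p
    using that by (elim payoff_index_cases) (auto simp: \<pi>_cell intro!: resp_cell_in_payoff_index \<tau>_in simp del: atLeastAtMost_iff)
  have \<pi>_inj: "inj_on \<pi> ?I"
  proof (rule inj_onI)
    fix p q assume pq: "p \<in> ?I" "q \<in> ?I" "\<pi> p = \<pi> q"
    obtain v x where v: "p = resp_cell v x" "x \<in> {1..m}" using pq(1) by (rule payoff_index_cases)
    obtain w y where w: "q = resp_cell w y" "y \<in> {1..m}" using pq(2) by (rule payoff_index_cases)
    show "p = q" using pq(3) v w \<tau>_bij[of v] by (auto simp: \<pi>_cell bij_betw_def inj_on_eq_iff)
  qed
  have distr: "distr M M (\<lambda>U. \<lambda>p\<in>?I. U (\<pi> p)) = M"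
    unfolding M_def using distr_PiM_reindex[of ?I "\<lambda>_. D" \<pi> ?I] D(1) \<pi>_inj \<pi>_in by auto
  have meas: "(\<lambda>U. \<lambda>p\<in>?I. U (\<pi> p)) \<in> M \<rightarrow>\<^sub>M M"
    unfolding M_def using \<pi>_in by (intro measurable_restrict measurable_component_singleton) auto
  have finS: "finite S" using S by (rule finite_subset) auto
  have [measurable]: "(\<lambda>U. best_resp m U v) \<in> M \<rightarrow>\<^sub>M count_space UNIV" if "v \<in> S" for v
    unfolding M_def using S that by (intro measurable_best_resp D) auto
  have sets: "{U\<in>space M. \<forall>v\<in>S. best_resp m U v = g v} \<in> sets M" for g
    using finS by measurable
  have "AE U in M. inj_on U ?I" unfolding M_def by (rule AE_payoffs_inj[OF D])
  hence AE: "AE U in M. (\<forall>v\<in>S. best_resp m (\<lambda>p\<in>?I. U (\<pi> p)) v = 1) \<longleftrightarrow>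
      (\<forall>v\<in>S. best_resp m U v = h v)"
  proof eventually_elim
    case (elim U)
    have "best_resp m (\<lambda>p\<in>?I. U (\<pi> p)) v = 1 \<longleftrightarrow> best_resp m U v = h v" if "v \<in> S" for v
    proof -
      have v: "v \<in> {1,2} \<times> {1..m}" using that S by auto
      have "best_resp m (\<lambda>p\<in>?I. U (\<pi> p)) v = arg_max_on (\<lambda>x. U (resp_cell v (\<tau> v x))) {1..m}"
        unfolding best_resp_def arg_max_on_def arg_max_def is_arg_max_linorder
        using resp_cell_in_payoff_index[OF v]
        by (intro arg_cong[of _ _ Eps] ext) (auto simp: \<pi>_cell)
      moreover have "inj_on (\<lambda>x. U (resp_cell v x)) {1..m}"
        using inj_onD[OF elim _ resp_cell_in_payoff_index[OF v] resp_cell_in_payoff_index[OF v]]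
        by (intro inj_onI) (simp only: resp_cell_eq_iff simp_thms)
      moreover have "\<tau> v 1 = h v" using that by (simp add: \<tau>_def)
      ultimately show ?thesis
        using arg_max_on_reindex_iff[of "{1..m}" "\<lambda>x. U (resp_cell v x)" 1 "\<tau> v"] \<tau>_bij \<open>m \<ge> 1\<close>
        by (simp add: best_resp_def)
    qed
    thus ?case by blast
  qed
  have "measure M {U\<in>space M. \<forall>v\<in>S. best_resp m U v = 1} =
      measure (distr M M (\<lambda>U. \<lambda>p\<in>?I. U (\<pi> p))) {U\<in>space M. \<forall>v\<in>S. best_resp m U v = 1}"
    by (simp only: distr)
  also have "\<dots> = measure M ((\<lambda>U. \<lambda>p\<in>?I. U (\<pi> p)) -` {U\<in>space M. \<forall>v\<in>S. best_resp m U v = 1} \<inter> space M)"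
    by (rule measure_distr[OF meas sets])
  also have "\<dots> = measure M {U\<in>space M. \<forall>v\<in>S. best_resp m U v = h v}"
  proof (rule measure_eq_AE)
    show "AE U in M. (U \<in> (\<lambda>U. \<lambda>p\<in>?I. U (\<pi> p)) -` {U\<in>space M. \<forall>v\<in>S. best_resp m U v = 1} \<inter> space M) =
        (U \<in> {U\<in>space M. \<forall>v\<in>S. best_resp m U v = h v})"
      using AE
    proof (rule AE_mp, intro AE_I2 impI)
      fix U assume U: "U \<in> space M"
        "(\<forall>v\<in>S. best_resp m (\<lambda>p\<in>?I. U (\<pi> p)) v = 1) \<longleftrightarrow> (\<forall>v\<in>S. best_resp m U v = h v)"
      have "(\<lambda>p\<in>?I. U (\<pi> p)) \<in> space M" using measurable_space[OF meas U(1)] .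
      with U show "(U \<in> (\<lambda>U. \<lambda>p\<in>?I. U (\<pi> p)) -` {U\<in>space M. \<forall>v\<in>S. best_resp m U v = 1} \<inter> space M) =
        (U \<in> {U\<in>space M. \<forall>v\<in>S. best_resp m U v = h v})" by simp
    qed
  qed (use measurable_sets[OF meas sets] sets in auto)
  finally show ?thesis ..
qed

text \<open>The events for the \<open>m ^ card S\<close> possible response patterns partition the
  space, and all have the probability of the constant pattern 1. Independence and uniformity come
  out together.\<close>

lemma prob_best_resp_eq:
  fixes D :: "real measure"
  assumes D: "prob_space D" "sets D = sets borel" "\<And>x. measure D {x} = 0"
    and "m \<ge> 1" and S: "S \<subseteq> {1,2} \<times> {1..m}" and h: "h \<in> S \<rightarrow> {1..m}"
  defines "M \<equiv> PiM (payoff_index m) (\<lambda>_. D)"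
  shows "measure M {U\<in>space M. \<forall>v\<in>S. best_resp m U v = h v} = 1 / real m ^ card S"
proof -
  interpret prob_space M unfolding M_def using D by (intro prob_space_PiM) auto
  have finS: "finite S" using S by (rule finite_subset) auto
  define E where "E g = {U\<in>space M. \<forall>v\<in>S. best_resp m U v = g v}" for g
  let ?H = "S \<rightarrow>\<^sub>E {1..m}"
  have [measurable]: "(\<lambda>U. best_resp m U v) \<in> M \<rightarrow>\<^sub>M count_space UNIV" if "v \<in> S" for v
    unfolding M_def using S that by (intro measurable_best_resp D) auto
  have sets: "E g \<in> sets M" for g
    unfolding E_def using finS by measurable
  have const: "prob (E g) = prob (E h)" if "g \<in> S \<rightarrow> {1..m}" for g
    unfolding E_def M_def
    using prob_best_resp_eq_const[OF D \<open>m \<ge> 1\<close> S that] prob_best_resp_eq_const[OF D \<open>m \<ge> 1\<close> S h] by simp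
  have "(\<Union>g\<in>?H. E g) = space M"
  proof (intro equalityI subsetI)
    fix U assume "U \<in> space M"
    hence "U \<in> E (\<lambda>v\<in>S. best_resp m U v)" by (auto simp: E_def)
    moreover have "(\<lambda>v\<in>S. best_resp m U v) \<in> ?H"
      using best_resp_in[OF \<open>m \<ge> 1\<close>] by (intro restrict_PiE_iff[THEN iffD2]) auto
    ultimately show "U \<in> (\<Union>g\<in>?H. E g)" by blast
  qed (auto simp: E_def)
  moreover have "prob (\<Union>g\<in>?H. E g) = (\<Sum>g\<in>?H. prob (E g))"
  proof (rule finite_measure_finite_Union)
    show "finite ?H" using finS by (intro finite_PiE) auto
    show "E ` ?H \<subseteq> sets M" using sets by auto
    show "disjoint_family_on E ?H"
      unfolding disjoint_family_on_def
    proof (intro ballI impI, rule ccontr)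
      fix f g assume fg: "f \<in> ?H" "g \<in> ?H" "f \<noteq> g" "E f \<inter> E g \<noteq> {}"
      then obtain U where "\<forall>v\<in>S. f v = g v" unfolding E_def by force
      hence "f = g" using fg by (intro PiE_ext) auto
      thus False using fg by simp
    qed
  qed
  ultimately have "1 = (\<Sum>g\<in>?H. prob (E g))" by (simp add: prob_space)
  also have "\<dots> = (\<Sum>g\<in>?H. prob (E h))" by (intro sum.cong refl const) auto
  also have "\<dots> = real m ^ card S * prob (E h)" using finS by (simp add: card_PiE)
  finally show ?thesis using \<open>m \<ge> 1\<close> unfolding E_def by (simp add: field_simps)
qed

section \<open>The exact cycle probability\<close>

text \<open>The answer to the current action becomes the action that the opponent answers next;
  \<open>3 - fst v\<close> exchanges players 1 and 2.\<close>

definition resp_step :: "nat \<Rightarrow> payoffs \<Rightarrow> nat \<times> nat \<Rightarrow> nat \<times> nat" where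
  "resp_step m U v = (3 - fst v, best_resp m U v)"

text \<open>Player 1 moves first, so \<open>fst a0\<close> is overwritten before anyone responds to
  it; the start is determined by \<open>snd a0\<close>.\<close>

definition resp_orbit :: "nat \<Rightarrow> payoffs \<Rightarrow> profile \<Rightarrow> nat \<Rightarrow> nat \<times> nat" where
  "resp_orbit m U a0 = (\<lambda>t. (resp_step m U ^^ t) (1, snd a0))"

lemma resp_orbit_simps:
  "resp_orbit m U a0 0 = (1, snd a0)"
  "resp_orbit m U a0 (Suc t) = resp_step m U (resp_orbit m U a0 t)"
  by (simp_all add: resp_orbit_def)

lemma fst_resp_orbit: "fst (resp_orbit m U a0 t) = (if even t then 1 else 2)"
  by (induction t) (auto simp: resp_orbit_simps resp_step_def)

lemma snd_resp_orbit_in: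
  assumes "m \<ge> 1" "snd a0 \<in> {1..m}"
  shows "snd (resp_orbit m U a0 t) \<in> {1..m}"
  using assms best_resp_in[OF assms(1)] by (cases t) (auto simp: resp_orbit_simps resp_step_def simp del: atLeastAtMost_iff One_nat_def)

lemma snd_resp_orbit_Suc:
  "snd (resp_orbit m U a0 (Suc t)) =
    (if even t then best_resp1 m U (snd (resp_orbit m U a0 t))
     else best_resp2 m U (snd (resp_orbit m U a0 t)))"
  using fst_resp_orbit[of m U a0 t]
  by (auto simp: resp_orbit_simps resp_step_def best_resp_def best_resp1_def best_resp2_def resp_cell_def)

text \<open>From time 1 on a profile consists of two consecutive orbit actions. The profile at time
  \<open>Suc t\<close> thus matches node \<open>t\<close>, which fits the condition
  \<open>\<tau> \<ge> 1\<close> in the definition of convergence.\<close>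

lemma cw_dyn_Suc_eq:
  "cw_dyn m U a0 (Suc t) =
    (if even t then (snd (resp_orbit m U a0 (Suc t)), snd (resp_orbit m U a0 t))
     else (snd (resp_orbit m U a0 t), snd (resp_orbit m U a0 (Suc t))))"
proof (induction t)
  case 0
  show ?case by (simp add: snd_resp_orbit_Suc resp_orbit_simps(1) clockwork_def)
next
  case (Suc t)
  have "cw_dyn m U a0 (Suc (Suc t)) = (let A = cw_dyn m U a0 (Suc t) in
      if even (Suc t) then (best_resp1 m U (snd A), snd A) else (fst A, best_resp2 m U (fst A)))"
    by (subst cw_dyn.simps) (auto simp: clockwork_def even_iff_mod_2_eq_zero mod_Suc simp del: cw_dyn.simps)
  thus ?case unfolding Suc by (simp add: snd_resp_orbit_Suc[of m U a0 "Suc t"])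
qed

text \<open>A profile contains the action of its node, and an even shift keeps the player;
  conversely a node determines the next one, hence both actions of the profile.\<close>

lemma cw_dyn_eq_iff:
  "cw_dyn m U a0 (Suc s) = cw_dyn m U a0 (Suc s + 2 * k) \<longleftrightarrow>
   resp_orbit m U a0 s = resp_orbit m U a0 (s + 2 * k)"
proof
  assume "cw_dyn m U a0 (Suc s) = cw_dyn m U a0 (Suc s + 2 * k)"
  hence "snd (resp_orbit m U a0 s) = snd (resp_orbit m U a0 (s + 2 * k))"
    by (simp add: cw_dyn_Suc_eq del: cw_dyn.simps split: if_splits)
  thus "resp_orbit m U a0 s = resp_orbit m U a0 (s + 2 * k)"
    by (simp add: prod_eq_iff fst_resp_orbit)
next
  assume *: "resp_orbit m U a0 s = resp_orbit m U a0 (s + 2 * k)"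
  hence "resp_orbit m U a0 (Suc s) = resp_orbit m U a0 (Suc (s + 2 * k))"
    by (simp add: resp_orbit_simps)
  with * show "cw_dyn m U a0 (Suc s) = cw_dyn m U a0 (Suc s + 2 * k)"
    by (simp add: cw_dyn_Suc_eq del: cw_dyn.simps)
qed

text \<open>The orbit alternates between the players, so it cannot match itself after an odd number
  of steps. Minimality among even shifts is therefore minimality among all shifts below
  \<open>2 * k\<close>, and the rho-shape lemma applies with period \<open>2 * k\<close>.\<close>

lemma converges_to_cycle_iff_first_return:
  assumes "k \<ge> 1"
  shows "converges_to_cycle m U a0 k \<longleftrightarrow>
    (\<exists>T\<ge>2 * k. inj_on (resp_orbit m U a0) {..<T} \<and>
       resp_orbit m U a0 T = resp_orbit m U a0 (T - 2 * k))"
proof -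
  let ?z = "resp_orbit m U a0"
  have odd: "?z s \<noteq> ?z (s + p)" if "odd p" for s p
    using fst_resp_orbit[of m U a0 s] fst_resp_orbit[of m U a0 "s + p"] that by (auto split: if_splits)
  have "converges_to_cycle m U a0 k \<longleftrightarrow>
      (\<exists>s. cw_dyn m U a0 (Suc s) = cw_dyn m U a0 (Suc s + 2 * k) \<and>
        (\<forall>k'. 1 \<le> k' \<and> k' < k \<longrightarrow> cw_dyn m U a0 (Suc s) \<noteq> cw_dyn m U a0 (Suc s + 2 * k')))"
  proof -
    have "(\<exists>\<tau>\<ge>1. Q \<tau>) \<longleftrightarrow> (\<exists>s. Q (Suc s))" for Q :: "nat \<Rightarrow> bool"
      by (auto simp: Suc_le_eq gr0_conv_Suc)
    thus ?thesis unfolding converges_to_cycle_def .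
  qed
  also have "\<dots> \<longleftrightarrow> (\<exists>s. ?z s = ?z (s + 2 * k) \<and> (\<forall>k'. 1 \<le> k' \<and> k' < k \<longrightarrow> ?z s \<noteq> ?z (s + 2 * k')))"
    unfolding cw_dyn_eq_iff ..
  also have "\<dots> \<longleftrightarrow> (\<exists>s. ?z s = ?z (s + 2 * k) \<and> (\<forall>p. 1 \<le> p \<and> p < 2 * k \<longrightarrow> ?z s \<noteq> ?z (s + p)))"
  proof -
    have "(\<forall>k'. 1 \<le> k' \<and> k' < k \<longrightarrow> ?z s \<noteq> ?z (s + 2 * k')) \<longleftrightarrow>
        (\<forall>p. 1 \<le> p \<and> p < 2 * k \<longrightarrow> ?z s \<noteq> ?z (s + p))" (is "?A \<longleftrightarrow> ?B") for s
    proof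
      assume A: ?A
      show ?B
      proof (intro allI impI)
        fix p assume p: "1 \<le> p \<and> p < 2 * k"
        show "?z s \<noteq> ?z (s + p)"
        proof (cases "even p")
          case True
          then obtain k' where "p = 2 * k'" by (elim evenE)
          thus ?thesis using A p by auto
        qed (rule odd)
      qed
    next
      assume B: ?B
      show ?A
      proof (intro allI impI)
        fix k' assume "1 \<le> k' \<and> k' < k"
        thus "?z s \<noteq> ?z (s + 2 * k')" using B[rule_format, of "2 * k'"] by linarith
      qed
    qed
    thus ?thesis by (simp only:)
  qed
  also have "\<dots> \<longleftrightarrow> (\<exists>T\<ge>2 * k. inj_on ?z {..<T} \<and> ?z T = ?z (T - 2 * k))"
    unfolding resp_orbit_def by (rule funpow_orbit_first_return) (use assms in simp)
  finally show ?thesis .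
qed

section \<open>The cycle event as a disjoint union over closed-up paths\<close>

abbreviation path_node :: "nat \<Rightarrow> nat \<Rightarrow> nat \<times> nat" where
  "path_node j a \<equiv> (if even j then 1 else 2, a)"

text \<open>The orbit runs through the path \<open>ys\<close> and then closes up by jumping back \<open>2 * k\<close> positions.\<close>

definition follows_path :: "nat \<Rightarrow> nat \<Rightarrow> nat list \<Rightarrow> payoffs \<Rightarrow> bool" where
  "follows_path m k ys U \<longleftrightarrow> (\<forall>j<length ys. best_resp m U (path_node j (ys ! j)) =
     (if Suc j < length ys then ys ! Suc j else ys ! (length ys - 2 * k)))"

lemma follows_path_orbit:
  assumes "k \<ge> 1" "T \<ge> 2 * k" "ys \<in> alt_paths m T" "snd a0 = ys ! 0" "follows_path m k ys U"
  shows "inj_on (resp_orbit m U a0) {..<T}"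
    and "resp_orbit m U a0 T = resp_orbit m U a0 (T - 2 * k)"
    and "ys = map (\<lambda>j. snd (resp_orbit m U a0 j)) [0..<T]"
proof -
  let ?z = "resp_orbit m U a0"
  have len: "length ys = T" using assms(3) by (simp add: alt_paths_def)
  have z: "?z j = path_node j (ys ! j)" if "j < T" for j
    using that
  proof (induction j)
    case 0
    thus ?case using assms(4) by (simp add: resp_orbit_simps)
  next
    case (Suc j)
    hence "?z j = path_node j (ys ! j)" by simp
    hence "?z (Suc j) = resp_step m U (path_node j (ys ! j))" by (simp only: resp_orbit_simps)
    moreover have "best_resp m U (path_node j (ys ! j)) = ys ! Suc j"
      using assms(5) Suc.prems len by (simp add: follows_path_def)
    ultimately show ?case by (simp add: resp_step_def)
  qed
  have inj: "\<And>i j. i < T \<Longrightarrow> j < T \<Longrightarrow> even (i + j) \<Longrightarrow> ys ! i = ys ! j \<Longrightarrow> i = j"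
    using assms(3) unfolding alt_paths_def by blast
  show "inj_on ?z {..<T}"
  proof (rule inj_onI)
    fix i j assume ij: "i \<in> {..<T}" "j \<in> {..<T}" "?z i = ?z j"
    hence "path_node i (ys ! i) = path_node j (ys ! j)" using z by simp
    hence "even (i + j)" "ys ! i = ys ! j" by (simp_all split: if_splits)
    thus "i = j" using ij by (auto dest: inj)
  qed
  obtain t where t: "T = Suc t" using assms(1,2) by (cases T) auto
  have "?z T = resp_step m U (path_node t (ys ! t))"
    using z[of t] t by (simp only: resp_orbit_simps lessI)
  moreover have "best_resp m U (path_node t (ys ! t)) = ys ! (T - 2 * k)"
    using assms(5) t len by (simp add: follows_path_def)
  ultimately have "?z T = path_node T (ys ! (T - 2 * k))" by (simp add: resp_step_def t)
  \<comment> \<open>The jump length is even, so positions \<open>T\<close> and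
    \<open>T - 2 * k\<close> belong to the same player.\<close>
  also have "\<dots> = ?z (T - 2 * k)" using z[of "T - 2 * k"] assms(1,2) by simp
  finally show "?z T = ?z (T - 2 * k)" .
  show "ys = map (\<lambda>j. snd (?z j)) [0..<T]"
    by (rule nth_equalityI) (simp_all add: len z)
qed

lemma converges_to_cycle_iff_follows_path:
  assumes "m \<ge> 1" "k \<ge> 1" "snd a0 \<in> {1..m}"
  shows "converges_to_cycle m U a0 k \<longleftrightarrow>
    (\<exists>T\<in>{2 * k..2 * m}. \<exists>ys\<in>alt_paths m T. snd a0 = ys ! 0 \<and> follows_path m k ys U)"
proof -
  let ?z = "resp_orbit m U a0"
  have "\<exists>T\<in>{2 * k..2 * m}. \<exists>ys\<in>alt_paths m T. snd a0 = ys ! 0 \<and> follows_path m k ys U"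
    if T: "T \<ge> 2 * k" "inj_on ?z {..<T}" "?z T = ?z (T - 2 * k)" for T
  proof -
    have T0: "T > 0" using T(1) assms(2) by simp
    define ys where "ys = map (\<lambda>j. snd (?z j)) [0..<T]"
    have z: "?z j = path_node j (snd (?z j))" for j
      by (simp add: prod_eq_iff fst_resp_orbit)
    have nth: "ys ! j = snd (?z j)" if "j < T" for j using that by (simp add: ys_def)
    have "?z ` {..<T} \<subseteq> {1,2} \<times> {1..m}"
    proof
      fix v assume "v \<in> ?z ` {..<T}"
      then obtain j where "v = ?z j" by blast
      thus "v \<in> {1,2} \<times> {1..m}"
        using fst_resp_orbit[of m U a0 j] snd_resp_orbit_in[OF assms(1,3), of U j]
        by (simp add: mem_Times_iff)
    qed
    \<comment> \<open>Pigeonhole: only \<open>2 * m\<close> nodes exist, which makes the union over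
      \<open>T\<close> finite.\<close>
    hence "card {..<T} \<le> card ({1,2::nat} \<times> {1..m})"
      by (intro card_inj_on_le[OF T(2)]) auto
    hence "T \<in> {2 * k..2 * m}" using T(1) by (simp add: card_cartesian_product)
    moreover have "ys \<in> alt_paths m T"
    proof -
      have "set ys \<subseteq> {1..m}"
        using snd_resp_orbit_in[OF assms(1,3)] by (auto simp: ys_def simp del: atLeastAtMost_iff One_nat_def)
      moreover have "i = j" if "i < T" "j < T" "even (i + j)" "ys ! i = ys ! j" for i j
      proof (rule inj_onD[OF T(2)])
        have "snd (?z i) = snd (?z j)" using that nth by simp
        moreover have "fst (?z i) = fst (?z j)" using that(3) by (simp add: fst_resp_orbit)
        ultimately show "?z i = ?z j" by (simp add: prod_eq_iff)
      qed (use that in auto)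
      ultimately show ?thesis by (simp add: alt_paths_def ys_def)
    qed
    moreover have "snd a0 = ys ! 0" using T0 by (simp add: nth resp_orbit_simps)
    moreover have "follows_path m k ys U"
      unfolding follows_path_def
    proof (intro allI impI)
      fix j assume "j < length ys"
      hence j: "j < T" by (simp add: ys_def)
      have "best_resp m U (path_node j (ys ! j)) = best_resp m U (?z j)"
        using z[of j] nth[OF j] by simp
      also have "\<dots> = snd (?z (Suc j))" by (simp add: resp_orbit_simps resp_step_def)
      also have "\<dots> = (if Suc j < T then ys ! Suc j else ys ! (T - 2 * k))"
      proof (cases "Suc j < T")
        case True
        thus ?thesis by (simp only: nth if_True)
      next
        case False
        hence "Suc j = T" using j by simp
        moreover have "ys ! (T - 2 * k) = snd (?z (T - 2 * k))" using T0 assms(2) by (intro nth) simp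
        ultimately show ?thesis using T(3) False by (simp only: if_False)
      qed
      finally show "best_resp m U (path_node j (ys ! j)) =
          (if Suc j < length ys then ys ! Suc j else ys ! (length ys - 2 * k))"
        by (simp add: ys_def)
    qed
    ultimately show ?thesis by blast
  qed
  moreover have "\<exists>T\<ge>2 * k. inj_on ?z {..<T} \<and> ?z T = ?z (T - 2 * k)"
    if "T \<in> {2 * k..2 * m}" "ys \<in> alt_paths m T" "snd a0 = ys ! 0" "follows_path m k ys U" for T ys
    using follows_path_orbit(1,2)[OF assms(2) _ that(2-4)] that(1) by auto
  ultimately show ?thesis
    unfolding converges_to_cycle_iff_first_return[OF assms(2)] by blast
qed

text \<open>Needed for disjointness. \<open>T\<close> is the first repetition time of the orbit, and
  the path is the orbit read up to \<open>T\<close>, so payoffs and start determine both.\<close>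

lemma follows_path_unique:
  fixes a0 :: profile
  assumes "k \<ge> 1" "T \<ge> 2 * k" "T' \<ge> 2 * k" "ys \<in> alt_paths m T" "ys' \<in> alt_paths m T'"
    and "snd a0 = ys ! 0" "snd a0 = ys' ! 0" "follows_path m k ys U" "follows_path m k ys' U"
  shows "T = T'" "ys = ys'"
proof -
  note o = follows_path_orbit(1)[OF assms(1,2,4,6,8)] follows_path_orbit(2)[OF assms(1,2,4,6,8)]
    follows_path_orbit(3)[OF assms(1,2,4,6,8)] follows_path_orbit(1)[OF assms(1,3,5,7,9)]
    follows_path_orbit(2)[OF assms(1,3,5,7,9)] follows_path_orbit(3)[OF assms(1,3,5,7,9)]
  let ?z = "resp_orbit m U a0"
  have *: False if "T1 \<ge> 2 * k" "T1 < T2" "inj_on ?z {..<T2}" "?z T1 = ?z (T1 - 2 * k)" for T1 T2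
    using inj_onD[OF that(3,4)] that(1,2) assms(1) by fastforce
  show "T = T'"
    using *[of T T'] *[of T' T] o assms by (meson linorder_cases)
  thus "ys = ys'" using o(3,6) by simp
qed

text \<open>Following the path prescribes the best response at \<open>T\<close> distinct nodes, each
  prescription costing a factor \<open>1 / m\<close>.\<close>

lemma prob_follows_path:
  fixes D :: "real measure"
  assumes D: "prob_space D" "sets D = sets borel" "\<And>x. measure D {x} = 0"
    and "m \<ge> 1" "k \<ge> 1" "T \<ge> 2 * k" and ys: "ys \<in> alt_paths m T"
  defines "M \<equiv> PiM (payoff_index m) (\<lambda>_. D)"
  shows "{U\<in>space M. follows_path m k ys U} \<in> sets M"
    and "measure M {U\<in>space M. follows_path m k ys U} = 1 / real m ^ T"
proof -
  have len: "length ys = T" using ys by (simp add: alt_paths_def)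
  define nd where "nd j = path_node j (ys ! j)" for j
  define w where "w j = (if Suc j < T then ys ! Suc j else ys ! (T - 2 * k))" for j
  \<comment> \<open>The prescriptions are indexed by position; inverting \<open>nd\<close>,
    injective on the positions below \<open>T\<close>, indexes them by node.\<close>
  define h where "h = w \<circ> the_inv_into {..<T} nd"
  have inj: "inj_on nd {..<T}"
  proof (rule inj_onI)
    fix i j assume ij: "i \<in> {..<T}" "j \<in> {..<T}" "nd i = nd j"
    moreover have "\<And>i j. i < T \<Longrightarrow> j < T \<Longrightarrow> even (i + j) \<Longrightarrow> ys ! i = ys ! j \<Longrightarrow> i = j"
      using ys unfolding alt_paths_def by blast
    ultimately show "i = j" by (auto simp: nd_def split: if_splits)
  qed
  have nth_in: "ys ! j \<in> {1..m}" if "j < T" for j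
    using that ys len by (auto simp: alt_paths_def subset_iff simp del: atLeastAtMost_iff One_nat_def)
  have h: "h (nd j) = w j" if "j < T" for j
    using that inj by (simp add: h_def the_inv_into_f_f)
  have w_in: "w j \<in> {1..m}" if "j < T" for j
    using that assms(5,6) by (auto simp: w_def intro!: nth_in simp del: atLeastAtMost_iff One_nat_def)
  have S: "nd ` {..<T} \<subseteq> {1,2} \<times> {1..m}"
    using nth_in by (auto simp: nd_def simp del: atLeastAtMost_iff One_nat_def)
  have eq: "{U\<in>space M. follows_path m k ys U} =
      {U\<in>space M. \<forall>v\<in>nd ` {..<T}. best_resp m U v = h v}"
  proof -
    have "follows_path m k ys U \<longleftrightarrow> (\<forall>j<T. best_resp m U (nd j) = w j)" for U
      by (simp only: follows_path_def len nd_def w_def)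
    thus ?thesis by (auto simp: h)
  qed
  have "h \<in> nd ` {..<T} \<rightarrow> {1..m}"
    using h w_in by (auto simp del: One_nat_def atLeastAtMost_iff One_nat_def)
  from prob_best_resp_eq[OF D \<open>m \<ge> 1\<close> S this]
  show "measure M {U\<in>space M. follows_path m k ys U} = 1 / real m ^ T"
    unfolding eq by (simp only: M_def card_image[OF inj] card_lessThan)
  have [measurable]: "(\<lambda>U. best_resp m U v) \<in> M \<rightarrow>\<^sub>M count_space UNIV" if "v \<in> nd ` {..<T}" for v
    unfolding M_def using S that by (intro measurable_best_resp D) auto
  have fin: "finite (nd ` {..<T})" by simp
  show "{U\<in>space M. follows_path m k ys U} \<in> sets M"
    unfolding eq using fin by measurable
qed

text \<open>A path of length \<open>T\<close> contributes \<open>1 / m ^ T\<close> from the payoffs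
  and \<open>1 / m\<close> from the start. Multiplying by the number of such paths distributes the
  powers of \<open>m\<close> over the factors of the product.\<close>

lemma cycle_prob_eq:
  fixes D :: "real measure"
  assumes D: "prob_space D" "sets D = sets borel" "\<And>x. measure D {x} = 0"
    and m: "m \<ge> 1" and k: "k \<ge> 1"
  shows "cycle_prob D m k =
    (\<Sum>T=2*k..2*m. \<Prod>j<T. (1 - real (j div 2) / real m)) / real m"
proof -
  let ?M = "PiM (payoff_index m) (\<lambda>_. D)"
  let ?N = "uniform_count_measure ({1..m} \<times> {1..m})"
  let ?G = "game_space D m"
  interpret M: prob_space ?M using D by (intro prob_space_PiM) auto
  interpret N: prob_space ?N using m by (intro prob_space_uniform_count_measure) auto
  interpret P: pair_prob_space ?M ?N ..
  have G: "?G = ?M \<Otimes>\<^sub>M ?N" by (simp add: game_space_def)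
  define X where "X = (SIGMA T:{2*k..2*m}. alt_paths m T)"
  define E1 where "E1 ys = {U\<in>space ?M. follows_path m k ys U}" for ys
  \<comment> \<open>Only the second starting action is constrained: \<open>m\<close> of the
    \<open>m * m\<close> profiles qualify.\<close>
  define E2 where "E2 ys = {a\<in>{1..m} \<times> {1..m}. snd a = ys ! 0}" for ys :: "nat list"
  define E where "E x = E1 (snd x) \<times> E2 (snd x)" for x :: "nat \<times> nat list"
  have finX: "finite X" unfolding X_def by (intro finite_SigmaI finite_alt_paths) auto
  have E1: "E1 ys \<in> sets ?M" "measure ?M (E1 ys) = 1 / real m ^ T"
    if "(T, ys) \<in> X" for T ys
    using prob_follows_path[OF D m k, of T ys] that unfolding E1_def X_def by auto
  have E2: "E2 ys \<in> sets ?N" "measure ?N (E2 ys) = 1 / real m" if "(T, ys) \<in> X" for T ys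
  proof -
    have "T > 0" "length ys = T" "set ys \<subseteq> {1..m}" using that k by (auto simp: X_def alt_paths_def)
    hence "ys ! 0 \<in> {1..m}" by (auto simp: subset_iff simp del: atLeastAtMost_iff One_nat_def)
    hence "E2 ys = {1..m} \<times> {ys ! 0}" by (auto simp: E2_def)
    hence c: "card (E2 ys) = m" by (simp add: card_cartesian_product)
    show "E2 ys \<in> sets ?N" by (auto simp: E2_def sets_uniform_count_measure)
    have "measure ?N (E2 ys) = real (card (E2 ys)) / real (card ({1..m} \<times> {1..m}))"
      by (rule measure_uniform_count_measure) (auto simp: E2_def)
    thus "measure ?N (E2 ys) = 1 / real m" using c m by (simp add: card_cartesian_product)
  qed
  have E: "E x \<in> sets ?G" "measure ?G (E x) = 1 / real m ^ Suc (fst x)" if "x \<in> X" for x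
  proof -
    obtain T ys where x: "x = (T, ys)" by force
    have 1: "E1 ys \<in> sets ?M" "E2 ys \<in> sets ?N" using E1 E2 that x by auto
    thus "E x \<in> sets ?G" by (simp add: E_def x G)
    have "emeasure ?G (E x) = emeasure ?M (E1 ys) * emeasure ?N (E2 ys)"
      unfolding G E_def x snd_conv by (rule N.emeasure_pair_measure_Times) fact+
    also have "\<dots> = ennreal (1 / real m ^ T * (1 / real m))"
      using E1(2)[of T ys] E2(2)[of T ys] that x
      by (simp add: M.emeasure_eq_measure N.emeasure_eq_measure ennreal_mult[symmetric] del: One_nat_def)
    finally show "measure ?G (E x) = 1 / real m ^ Suc (fst x)"
      by (simp add: measure_def x mult.commute)
  qed
  have "{\<omega>\<in>space ?G. converges_to_cycle m (fst \<omega>) (snd \<omega>) k} = (\<Union>x\<in>X. E x)"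
  proof -
    have *: "converges_to_cycle m (fst \<omega>) (snd \<omega>) k \<longleftrightarrow> \<omega> \<in> (\<Union>x\<in>X. E x)"
      if "\<omega> \<in> space ?M \<times> ({1..m} \<times> {1..m})" for \<omega>
    proof -
      have "snd (snd \<omega>) \<in> {1..m}" using that by (auto simp: mem_Times_iff)
      note conv = converges_to_cycle_iff_follows_path[OF m k this, of "fst \<omega>"]
      have "\<omega> \<in> E (T, ys) \<longleftrightarrow> snd (snd \<omega>) = ys ! 0 \<and> follows_path m k ys (fst \<omega>)" for T ys
        using that unfolding E_def E1_def E2_def mem_Times_iff mem_Collect_eq snd_conv by blast
      moreover have "\<omega> \<in> (\<Union>x\<in>X. E x) \<longleftrightarrow> (\<exists>T\<in>{2*k..2*m}. \<exists>ys\<in>alt_paths m T. \<omega> \<in> E (T, ys))"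
        unfolding X_def by blast
      ultimately show ?thesis using conv by (simp only:)
    qed
    have sub: "(\<Union>x\<in>X. E x) \<subseteq> space ?M \<times> ({1..m} \<times> {1..m})"
      unfolding E_def E1_def E2_def by blast
    have sp: "space ?G = space ?M \<times> ({1..m} \<times> {1..m})"
      by (simp add: G space_pair_measure space_uniform_count_measure)
    show ?thesis
    proof (rule set_eqI)
      fix \<omega>
      show "\<omega> \<in> {\<omega>\<in>space ?G. converges_to_cycle m (fst \<omega>) (snd \<omega>) k} \<longleftrightarrow> \<omega> \<in> (\<Union>x\<in>X. E x)"
        unfolding sp mem_Collect_eq using *[of \<omega>] subsetD[OF sub, of \<omega>] by argo
    qed
  qed
  hence "cycle_prob D m k = measure ?G (\<Union>x\<in>X. E x)" by (simp add: cycle_prob_def)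
  also have "\<dots> = (\<Sum>x\<in>X. measure ?G (E x))"
    unfolding G
  proof (rule P.finite_measure_finite_Union[OF finX])
    show "E ` X \<subseteq> sets (?M \<Otimes>\<^sub>M ?N)" using E(1) unfolding G by auto
    show "disjoint_family_on E X"
      unfolding disjoint_family_on_def
    proof (intro ballI impI, rule ccontr)
      fix x y assume xy: "x \<in> X" "y \<in> X" "x \<noteq> y" "E x \<inter> E y \<noteq> {}"
      then obtain U a where Ua: "(U, a) \<in> E x" "(U, a) \<in> E y" by auto
      have "fst x = fst y \<and> snd x = snd y"
        using follows_path_unique[OF k, of "fst x" "fst y" "snd x" m "snd y" a U] xy(1,2) Ua
        by (auto simp: X_def E_def E1_def E2_def)
      thus False using xy(3) by (simp add: prod_eq_iff)
    qed
  qed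
  also have "\<dots> = (\<Sum>x\<in>X. 1 / real m ^ Suc (fst x))" using E(2) by (intro sum.cong) auto
  also have "\<dots> = (\<Sum>T=2*k..2*m. \<Sum>ys\<in>alt_paths m T. 1 / real m ^ Suc T)"
    unfolding X_def by (subst sum.Sigma) (auto simp: finite_alt_paths split_def)
  also have "\<dots> = (\<Sum>T=2*k..2*m. (\<Prod>j<T. (1 - real (j div 2) / real m)) / real m)"
  proof (rule sum.cong[OF refl])
    fix T assume T: "T \<in> {2*k..2*m}"
    \<comment> \<open>Since \<open>T <= 2 * m\<close>, the natural subtraction in the path count is
      never truncated.\<close>
    have "(\<Prod>j<T. (1 - real (j div 2) / real m)) = (\<Prod>j<T. real (m - j div 2) / real m)"
    proof (rule prod.cong[OF refl])
      fix j assume "j \<in> {..<T}"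
      hence "j div 2 \<le> m" using T by auto
      thus "1 - real (j div 2) / real m = real (m - j div 2) / real m"
        using m by (simp add: field_simps)
    qed
    also have "\<dots> = real (card (alt_paths m T)) / real m ^ T"
      by (simp add: prod_dividef card_alt_paths)
    finally show "(\<Sum>ys\<in>alt_paths m T. 1 / real m ^ Suc T) =
        (\<Prod>j<T. (1 - real (j div 2) / real m)) / real m"
      by (simp add: mult.commute)
  qed
  finally show ?thesis by (simp add: sum_divide_distrib)
qed

section \<open>Gaussian asymptotics\<close>

text \<open>The sum is the floor of t^2 / 4; keeping the remainder \<open>t mod 2\<close> avoids
  division. It is the source of the exponent -t^2 / (4 m).\<close>

lemma sum_div_2_identity: "4 * (\<Sum>j<Suc t. j div 2) + t mod 2 = t\<^sup>2"
proof (induction t)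
  case (Suc t)
  have "4 * (Suc t div 2) + Suc t mod 2 = 2 * t + 1 + t mod 2"
    by (cases "even t") (auto elim!: evenE oddE)
  with Suc show ?case by (simp add: power2_eq_square)
qed simp

lemma real_sum_div_2: "(\<Sum>j<Suc t. real (j div 2)) = ((real t)\<^sup>2 - real (t mod 2)) / 4"
proof -
  have "real (4 * (\<Sum>j<Suc t. j div 2) + t mod 2) = real (t\<^sup>2)"
    by (simp only: sum_div_2_identity)
  thus ?thesis by (simp del: sum.lessThan_Suc)
qed

text \<open>From \<open>1 - x <= exp (- x)\<close> factor by factor; the parity remainder costs at
  most \<open>exp (1 / (4 * m))\<close>.\<close>

lemma birthday_prod_le:
  assumes "m \<ge> 1" "t < 2 * m"
  shows "(\<Prod>j<Suc t. (1 - real (j div 2) / real m))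
           \<le> exp (1 / (4 * real m)) * exp (- (real t)\<^sup>2 / (4 * real m))"
proof -
  have "(\<Prod>j<Suc t. (1 - real (j div 2) / real m)) \<le> (\<Prod>j<Suc t. exp (- (real (j div 2) / real m)))"
  proof (rule prod_mono)
    fix j assume "j \<in> {..<Suc t}"
    hence "j div 2 \<le> m" using assms by auto
    thus "0 \<le> 1 - real (j div 2) / real m \<and> 1 - real (j div 2) / real m \<le> exp (- (real (j div 2) / real m))"
      using assms exp_ge_add_one_self[of "- (real (j div 2) / real m)"] by (simp add: field_simps)
  qed
  also have "\<dots> = exp (- (\<Sum>j<Suc t. real (j div 2)) / real m)"
    by (simp only: exp_sum[OF finite_lessThan, symmetric] sum_negf sum_divide_distrib[symmetric] minus_divide_left)
  also have "\<dots> = exp (real (t mod 2) / (4 * real m) + - (real t)\<^sup>2 / (4 * real m))"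
    unfolding real_sum_div_2 by (simp add: diff_divide_distrib)
  also have "\<dots> \<le> exp (1 / (4 * real m) + - (real t)\<^sup>2 / (4 * real m))"
  proof -
    have "real (t mod 2) \<le> 1" by simp
    hence "real (t mod 2) / (4 * real m) \<le> 1 / (4 * real m)" by (rule divide_right_mono) simp
    thus ?thesis by simp
  qed
  finally show ?thesis by (simp only: exp_add)
qed

text \<open>Uses ln (1 - x) >= - x - 2 x^2 on [0, 1/2], where \<open>N <= m\<close> keeps every
  \<open>x j\<close>. At most \<open>N\<close> quadratic terms, each with
  \<open>x j <= N / (2 * m)\<close>, add up to at most half of N^3 / m^2; the parity remainder has
  the favourable sign.\<close>

lemma birthday_prod_ge:
  assumes "m \<ge> 1" "t < N" "N \<le> m"
  shows "exp (- (real N ^ 3 / (real m)\<^sup>2)) * exp (- (real t)\<^sup>2 / (4 * real m))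
           \<le> (\<Prod>j<Suc t. (1 - real (j div 2) / real m))"
proof -
  define x where "x j = real (j div 2) / real m" for j
  have x: "0 \<le> x j" "x j \<le> real N / (2 * real m)" "x j \<le> 1 / 2" if "j \<le> t" for j
  proof -
    have "2 * (j div 2) \<le> N" using that assms by linarith
    hence N: "2 * real (j div 2) \<le> real N" by linarith
    show "0 \<le> x j" by (simp add: x_def)
    show "x j \<le> real N / (2 * real m)" using N assms by (simp add: x_def field_simps)
    also have "\<dots> \<le> 1 / 2" using assms by (simp add: field_simps)
    finally show "x j \<le> 1 / 2" .
  qed
  have "(\<Sum>j<Suc t. 2 * (x j)\<^sup>2) \<le> (\<Sum>j<Suc t. 2 * (real N / (2 * real m))\<^sup>2)"
    using x by (intro sum_mono mult_left_mono power_mono) auto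
  also have "\<dots> = real (Suc t) * (2 * (real N / (2 * real m))\<^sup>2)" by simp
  also have "\<dots> \<le> real N * (2 * (real N / (2 * real m))\<^sup>2)"
    using assms by (intro mult_right_mono) auto
  also have "\<dots> = real N ^ 3 / (real m)\<^sup>2 / 2"
    using assms by (simp add: power2_eq_square power3_eq_cube field_simps)
  also have "\<dots> \<le> real N ^ 3 / (real m)\<^sup>2"
  proof -
    have half: "y / 2 \<le> y" if "0 \<le> y" for y :: real using that by simp
    show ?thesis by (rule half) simp
  qed
  finally have sq: "(\<Sum>j<Suc t. 2 * (x j)\<^sup>2) \<le> real N ^ 3 / (real m)\<^sup>2" .
  have "(\<Sum>j<Suc t. x j) = ((real t)\<^sup>2 - real (t mod 2)) / 4 / real m"
    unfolding x_def by (simp only: sum_divide_distrib[symmetric] real_sum_div_2)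
  also have "\<dots> \<le> (real t)\<^sup>2 / (4 * real m)" using assms by (simp add: field_simps)
  finally have "- (real N ^ 3 / (real m)\<^sup>2) + - (real t)\<^sup>2 / (4 * real m)
      \<le> - (\<Sum>j<Suc t. x j) - (\<Sum>j<Suc t. 2 * (x j)\<^sup>2)"
    using sq by linarith
  also have "\<dots> = (\<Sum>j<Suc t. - x j - 2 * (x j)\<^sup>2)"
    by (simp only: sum_subtractf sum_negf)
  finally have "exp (- (real N ^ 3 / (real m)\<^sup>2) + - (real t)\<^sup>2 / (4 * real m))
      \<le> exp (\<Sum>j<Suc t. - x j - 2 * (x j)\<^sup>2)" by simp
  also have "\<dots> = (\<Prod>j<Suc t. exp (- x j - 2 * (x j)\<^sup>2))" by (rule exp_sum) simp
  also have "\<dots> \<le> (\<Prod>j<Suc t. 1 - x j)"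
  proof (rule prod_mono)
    fix j assume "j \<in> {..<Suc t}"
    hence xj: "0 \<le> x j" "x j \<le> 1 / 2" using x by auto
    hence "- x j - 2 * (x j)\<^sup>2 \<le> ln (1 - x j)" by (rule ln_one_minus_pos_lower_bound)
    hence "exp (- x j - 2 * (x j)\<^sup>2) \<le> exp (ln (1 - x j))" by simp
    also have "\<dots> = 1 - x j" using xj by simp
    finally show "0 \<le> exp (- x j - 2 * (x j)\<^sup>2) \<and> exp (- x j - 2 * (x j)\<^sup>2) \<le> 1 - x j" by simp
  qed
  finally show ?thesis by (simp only: exp_add x_def)
qed

text \<open>The substitution \<open>y = x / sqrt (2 * m)\<close> turns the Gaussian weight \<open>exp (- x\<^sup>2 / (4 * m))\<close>
  into a multiple of the standard normal density.\<close>

lemma gauss_increment_bounds: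
  fixes m x d :: real
  assumes "m > 0" "x \<ge> 0" "d \<ge> 0"
  defines "\<Delta> \<equiv> 2 * sqrt (pi * m) * (Phi ((x + d) / sqrt (2 * m)) - Phi (x / sqrt (2 * m)))"
  shows "d * exp (- (x + d)\<^sup>2 / (4 * m)) \<le> \<Delta>" "\<Delta> \<le> d * exp (- x\<^sup>2 / (4 * m))"
proof -
  let ?c = "sqrt (2 * m)"
  have c: "?c > 0" using assms by simp
  have K: "2 * sqrt (pi * m) = ?c * sqrt (2 * pi)"
    by (simp add: real_sqrt_mult)
  have dens: "sqrt (2 * pi) * std_normal_density (y / ?c) = exp (- y\<^sup>2 / (4 * m))" for y
    using assms by (simp add: std_normal_density_def power_divide field_simps)
  have diff: "(x + d) / ?c - x / ?c = d / ?c" by (simp add: add_divide_distrib)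
  have "d * exp (- (x + d)\<^sup>2 / (4 * m)) = 2 * sqrt (pi * m) * (d / ?c * std_normal_density ((x + d) / ?c))"
    unfolding K dens[symmetric] using c by (simp add: field_simps)
  also have "\<dots> \<le> \<Delta>"
    unfolding \<Delta>_def using Phi_diff_ge[of "x / ?c" "(x + d) / ?c"] assms c
    by (intro mult_left_mono) (auto simp: diff divide_right_mono)
  finally show "d * exp (- (x + d)\<^sup>2 / (4 * m)) \<le> \<Delta>" .
  have "\<Delta> \<le> 2 * sqrt (pi * m) * (d / ?c * std_normal_density (x / ?c))"
    unfolding \<Delta>_def using Phi_diff_le[of "x / ?c" "(x + d) / ?c"] assms c
    by (intro mult_left_mono) (auto simp: diff divide_right_mono)
  also have "\<dots> = d * exp (- x\<^sup>2 / (4 * m))"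
    unfolding K dens[symmetric] using c by (simp add: field_simps)
  finally show "\<Delta> \<le> d * exp (- x\<^sup>2 / (4 * m))" .
qed

section \<open>Comparing Gaussian sums with Gaussian integrals\<close>

lemma gauss_sum_le:
  fixes m :: real
  assumes "m > 0"
  shows "(\<Sum>t=a..b. exp (- (real t)\<^sup>2 / (4 * m)))
    \<le> exp (- (real a)\<^sup>2 / (4 * m)) + 2 * sqrt (pi * m) * (1 - Phi (real a / sqrt (2 * m)))"
proof -
  let ?g = "\<lambda>t. exp (- (real t)\<^sup>2 / (4 * m))"
  \<comment> \<open>By monotonicity each term after the first is at most the integral over the unit
    interval to its left; the first has no such interval within the range and stays
    separate.\<close>
  have *: "(\<Sum>t=a..a+i. ?g t) \<le> ?g a + 2 * sqrt (pi * m) * (Phi (real (a + i) / sqrt (2 * m)) - Phi (real a / sqrt (2 * m)))" for i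
  proof (induction i)
    case (Suc i)
    have "?g (a + Suc i) \<le> 2 * sqrt (pi * m) *
        (Phi (real (a + Suc i) / sqrt (2 * m)) - Phi (real (a + i) / sqrt (2 * m)))"
      using gauss_increment_bounds(1)[OF assms, of "real (a + i)" 1] by (simp add: add_ac)
    moreover have "(\<Sum>t=a..a + Suc i. ?g t) = (\<Sum>t=a..a+i. ?g t) + ?g (a + Suc i)" by simp
    ultimately show ?case using Suc by (simp add: right_diff_distrib)
  qed simp
  have "(\<Sum>t=a..b. ?g t) \<le> (\<Sum>t=a..a+b. ?g t)" by (rule sum_mono2) auto
  also have "\<dots> \<le> ?g a + 2 * sqrt (pi * m) * (Phi (real (a + b) / sqrt (2 * m)) - Phi (real a / sqrt (2 * m)))"
    by (rule *)
  also have "\<dots> \<le> ?g a + 2 * sqrt (pi * m) * (1 - Phi (real a / sqrt (2 * m)))"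
    using Phi_le_1 assms by (intro add_left_mono mult_left_mono diff_right_mono) auto
  finally show ?thesis .
qed

lemma gauss_sum_ge:
  fixes m :: real
  assumes "m > 0"
  shows "2 * sqrt (pi * m) * (Phi (real (a + i) / sqrt (2 * m)) - Phi (real a / sqrt (2 * m)))
    \<le> (\<Sum>t=a..<a+i. exp (- (real t)\<^sup>2 / (4 * m)))"
proof (induction i)
  case (Suc i)
  let ?g = "\<lambda>t. exp (- (real t)\<^sup>2 / (4 * m))"
  have "2 * sqrt (pi * m) * (Phi (real (a + Suc i) / sqrt (2 * m)) - Phi (real (a + i) / sqrt (2 * m)))
      \<le> ?g (a + i)"
    using gauss_increment_bounds(2)[OF assms, of "real (a + i)" 1] by (simp add: add_ac)
  moreover have "(\<Sum>t=a..<a + Suc i. ?g t) = (\<Sum>t=a..<a+i. ?g t) + ?g (a + i)" by simp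
  ultimately show ?case using Suc by (simp add: right_diff_distrib)
qed simp

text \<open>The integral of exp (- x^2 / (4 m)) over x > 2k - 1, which is \<open>m\<close> times the
  claimed asymptotic value. Likewise \<open>birthday_sum\<close> is \<open>m\<close> times the exact
  probability.\<close>

definition gauss_main :: "nat \<Rightarrow> nat \<Rightarrow> real" where
  "gauss_main m k = 2 * sqrt (pi * real m) * (1 - Phi ((2 * real k - 1) / sqrt (2 * real m)))"

definition birthday_sum :: "nat \<Rightarrow> nat \<Rightarrow> real" where
  "birthday_sum m k = (\<Sum>T=2*k..2*m. \<Prod>j<T. (1 - real (j div 2) / real m))"

lemma gauss_main_pos: "m \<ge> 1 \<Longrightarrow> k \<ge> 1 \<Longrightarrow> gauss_main m k > 0"
  unfolding gauss_main_def using Phi_less_1[of "(2 * real k - 1) / sqrt (2 * real m)"] by simp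

text \<open>Substituting \<open>T = t + 1\<close> aligns the summation index with the Gaussian
  exponent; this is where \<open>2k - 1\<close> comes from.\<close>

lemma birthday_sum_shift:
  assumes "m \<ge> 1" "k \<ge> 1"
  shows "birthday_sum m k = (\<Sum>t=2*k-1..2*m-1. \<Prod>j<Suc t. (1 - real (j div 2) / real m))"
proof -
  have "2 * k = Suc (2 * k - 1)" "2 * m = Suc (2 * m - 1)" using assms by auto
  thus ?thesis unfolding birthday_sum_def
    by (metis (no_types, lifting) sum.cong sum.shift_bounds_cl_Suc_ivl)
qed

text \<open>The isolated first Gaussian term is made relative to the tail: moving from
  \<open>a\<close> to \<open>a + d\<close> costs an explicit exponential factor, and
  \<open>d\<close> times the value at \<open>a + d\<close> lies below the integral over that
  stretch. The length \<open>d\<close> is left free to be balanced later.\<close>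

lemma birthday_sum_le:
  assumes "m \<ge> 1" "k \<ge> 1" "d > 0"
  shows "birthday_sum m k \<le> exp (1 / (4 * real m)) *
    (1 + exp ((2 * (2 * real k - 1) * d + d\<^sup>2) / (4 * real m)) / d) * gauss_main m k"
proof -
  define a where "a = 2 * k - 1"
  have a: "real a = 2 * real k - 1" using assms by (simp add: a_def)
  let ?g = "\<lambda>x::real. exp (- x\<^sup>2 / (4 * real m))"
  have G: "gauss_main m k = 2 * sqrt (pi * real m) * (1 - Phi (real a / sqrt (2 * real m)))"
    by (simp add: gauss_main_def a)
  have "birthday_sum m k \<le> (\<Sum>t=a..2*m-1. exp (1 / (4 * real m)) * ?g (real t))"
    unfolding birthday_sum_shift[OF assms(1,2)] a_def using assms
    by (intro sum_mono birthday_prod_le) auto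
  also have "\<dots> = exp (1 / (4 * real m)) * (\<Sum>t=a..2*m-1. ?g (real t))"
    by (simp only: sum_distrib_left)
  also have "\<dots> \<le> exp (1 / (4 * real m)) * (?g (real a) + gauss_main m k)"
    unfolding G using assms by (intro mult_left_mono gauss_sum_le) auto
  also have "?g (real a) \<le> exp ((2 * real a * d + d\<^sup>2) / (4 * real m)) / d * gauss_main m k"
  proof -
    have "?g (real a) = exp ((2 * real a * d + d\<^sup>2) / (4 * real m)) * ?g (real a + d)"
      unfolding exp_add[symmetric] using assms by (simp add: field_simps power2_sum)
    moreover have "d * ?g (real a + d) \<le> 2 * sqrt (pi * real m) *
        (Phi ((real a + d) / sqrt (2 * real m)) - Phi (real a / sqrt (2 * real m)))"
      using assms by (intro gauss_increment_bounds(1)) auto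
    moreover have "\<dots> \<le> gauss_main m k"
      unfolding G using Phi_le_1 by (intro mult_left_mono diff_right_mono) auto
    ultimately show ?thesis using assms
      by (simp add: field_simps mult_left_mono)
  qed
  finally show ?thesis by (simp add: a algebra_simps)
qed

text \<open>Keep only \<open>h\<close> terms. The shift inequality for the normal tail bounds the
  discarded part of the integral by the fraction exp (- h^2 / (4 m)), and on the window the cubic
  correction is uniform.\<close>

lemma birthday_sum_ge:
  assumes "m \<ge> 1" "k \<ge> 1" "2 * k - 1 + h \<le> m"
  shows "exp (- (real (2 * k - 1 + h) ^ 3 / (real m)\<^sup>2)) * (1 - exp (- (real h)\<^sup>2 / (4 * real m))) *
    gauss_main m k \<le> birthday_sum m k"
proof -
  define a where "a = 2 * k - 1"
  have a: "real a = 2 * real k - 1" using assms by (simp add: a_def)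
  let ?c = "sqrt (2 * real m)"
  let ?g = "\<lambda>x::real. exp (- x\<^sup>2 / (4 * real m))"
  let ?e = "exp (- (real (a + h) ^ 3 / (real m)\<^sup>2))"
  have "1 - Phi (real a / ?c + real h / ?c) \<le> exp (- ((real h / ?c)\<^sup>2) / 2) * (1 - Phi (real a / ?c))"
    by (rule one_minus_Phi_shift_le) auto
  hence "(1 - exp (- (real h)\<^sup>2 / (4 * real m))) * (1 - Phi (real a / ?c))
      \<le> Phi (real (a + h) / ?c) - Phi (real a / ?c)"
    by (simp add: power_divide algebra_simps add_divide_distrib)
  hence "2 * sqrt (pi * real m) * ((1 - exp (- (real h)\<^sup>2 / (4 * real m))) * (1 - Phi (real a / ?c)))
      \<le> 2 * sqrt (pi * real m) * (Phi (real (a + h) / ?c) - Phi (real a / ?c))"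
    by (intro mult_left_mono) auto
  also have "\<dots> \<le> (\<Sum>t=a..<a+h. ?g (real t))"
    using assms by (intro gauss_sum_ge) auto
  finally have "(1 - exp (- (real h)\<^sup>2 / (4 * real m))) * gauss_main m k \<le> (\<Sum>t=a..<a+h. ?g (real t))"
    by (simp add: gauss_main_def a mult_ac)
  hence "?e * ((1 - exp (- (real h)\<^sup>2 / (4 * real m))) * gauss_main m k) \<le> ?e * (\<Sum>t=a..<a+h. ?g (real t))"
    by (intro mult_left_mono) auto
  also have "\<dots> = (\<Sum>t=a..<a+h. ?e * ?g (real t))" by (simp only: sum_distrib_left)
  also have "\<dots> \<le> (\<Sum>t=a..<a+h. \<Prod>j<Suc t. (1 - real (j div 2) / real m))"
    using assms by (intro sum_mono birthday_prod_ge) (auto simp: a_def)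
  also have "\<dots> \<le> birthday_sum m k"
    unfolding birthday_sum_shift[OF assms(1,2)] a_def[symmetric]
  proof (rule sum_mono2)
    show "{a..<a + h} \<subseteq> {a..2 * m - 1}" using assms by (auto simp: a_def)
    fix t assume t: "t \<in> {a..2 * m - 1} - {a..<a + h}"
    show "0 \<le> (\<Prod>j<Suc t. (1 - real (j div 2) / real m))"
    proof (rule prod_nonneg)
      fix j assume "j \<in> {..<Suc t}"
      hence "j div 2 \<le> m" using t by auto
      thus "0 \<le> 1 - real (j div 2) / real m" using assms by (simp add: field_simps)
    qed
  qed simp
  finally show ?thesis by (simp add: a_def mult.assoc)
qed

lemma birthday_sum_ratio_tendsto:
  fixes k :: "nat \<Rightarrow> nat"
  assumes k: "\<And>m. k m \<ge> 1" and small: "(\<lambda>m. real (k m)) \<in> o(\<lambda>m. real m powr (2/3))"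
  shows "(\<lambda>m. birthday_sum m (k m) / gauss_main m (k m)) \<longlonglongrightarrow> 1"
proof -
  define r where "r m = real (k m) / real m powr (2/3)" for m
  have r: "r \<longlonglongrightarrow> 0" unfolding r_def using small by (rule smalloD_tendsto)
  have kr: "real (k m) = r m * real m powr (2/3)" if "m \<ge> 1" for m
    using that by (simp add: r_def)
  \<comment> \<open>This is the upper factor at \<open>d = m powr (1/3)\<close>: the exponent (2 (2k
    - 1) d + d^2) / (4 m) becomes \<open>r m\<close> plus negative powers of \<open>m\<close>, and
    the division by \<open>d\<close> makes the extra term vanish.\<close>
  define up where "up m = exp (1 / (4 * real m)) *
    (1 + exp (r m - real m powr (-2/3) / 2 + real m powr (-1/3) / 4) / real m powr (1/3))" for m
  \<comment> \<open>\<open>q m * m powr (2/3)\<close> bounds the end of the window: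
    \<open>2 * k\<close> gives \<open>2 * r m\<close>, and the window length gives the exponent 3/5
    - 2/3 = -1/15. Its cube divided by m^2 is \<open>q m ^ 3\<close>.\<close>
  define q where "q m = 2 * r m + real m powr (-1/15)" for m
  define lo where "lo m = exp (- (q m ^ 3)) * (1 - exp (- (real m powr (1/5) / 4)))" for m
  have q: "q \<longlonglongrightarrow> 0"
  proof -
    have "(\<lambda>m. real m powr (-1/15)) \<longlonglongrightarrow> 0" by real_asymp
    from tendsto_add[OF tendsto_mult[OF tendsto_const[of 2] r] this] show ?thesis
      unfolding q_def by simp
  qed
  have lo: "lo \<longlonglongrightarrow> 1"
  proof -
    have "(\<lambda>m::nat. 1 - exp (- (real m powr (1/5) / 4))) \<longlonglongrightarrow> 1" by real_asymp
    moreover have "(\<lambda>m. exp (- (q m ^ 3))) \<longlonglongrightarrow> exp (- (0 ^ 3))"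
      by (intro tendsto_intros q)
    ultimately show ?thesis unfolding lo_def using tendsto_mult by fastforce
  qed
  have up: "up \<longlonglongrightarrow> 1"
  proof -
    have "(\<lambda>m::nat. exp (1 / (4 * real m))) \<longlonglongrightarrow> 1" by real_asymp
    moreover have "(\<lambda>m. r m - real m powr (-2/3) / 2 + real m powr (-1/3) / 4) \<longlonglongrightarrow> 0 - 0 + 0"
      by (rule tendsto_add[OF tendsto_diff[OF r]]; real_asymp)
    hence "(\<lambda>m. exp (r m - real m powr (-2/3) / 2 + real m powr (-1/3) / 4)) \<longlonglongrightarrow> 1"
      using tendsto_exp by fastforce
    moreover have "(\<lambda>m::nat. 1 / real m powr (1/3)) \<longlonglongrightarrow> 0" by real_asymp
    ultimately have "(\<lambda>m. exp (1 / (4 * real m)) *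
        (1 + exp (r m - real m powr (-2/3) / 2 + real m powr (-1/3) / 4) * (1 / real m powr (1/3))))
        \<longlonglongrightarrow> 1 * (1 + 1 * 0)"
      by (intro tendsto_mult tendsto_add tendsto_const)
    thus ?thesis unfolding up_def by simp
  qed
  have "eventually (\<lambda>m. q m < 1) sequentially" using q by (rule order_tendstoD) simp
  hence "eventually (\<lambda>m. lo m \<le> birthday_sum m (k m) / gauss_main m (k m)) sequentially"
    using eventually_ge_at_top[of 1]
  proof eventually_elim
    case (elim m)
    define h where "h = nat \<lceil>real m powr (3/5)\<rceil>"
    define N where "N = 2 * k m - 1 + h"
    have h: "real m powr (3/5) \<le> real h" "real h \<le> real m powr (3/5) + 1"
      unfolding h_def by (simp_all add: real_nat_ceiling_ge)
    \<comment> \<open>The -1 in \<open>2 * k m - 1\<close> absorbs the rounding error of the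
      ceiling.\<close>
    have "real N \<le> 2 * real (k m) + real m powr (3/5)"
      using h k[of m] by (simp add: N_def)
    also have "\<dots> = q m * real m powr (2/3)"
      using elim by (simp add: kr q_def algebra_simps flip: powr_add)
    finally have N: "real N \<le> q m * real m powr (2/3)" .
    have pw: "real m powr (2/3) \<le> real m"
      using powr_mono[of "2/3" 1 "real m"] elim by simp
    have "q m * real m powr (2/3) \<le> 1 * real m powr (2/3)"
      using elim by (intro mult_right_mono) auto
    with N pw have "real N \<le> real m" by linarith
    hence Nm: "N \<le> m" by simp
    have "real N ^ 3 \<le> (q m * real m powr (2/3)) ^ 3"
      using N by (intro power_mono) auto
    also have "\<dots> = q m ^ 3 * (real m)\<^sup>2"
      using elim by (simp add: power_mult_distrib powr_powr flip: powr_numeral)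
    finally have 1: "real N ^ 3 / (real m)\<^sup>2 \<le> q m ^ 3"
      using elim by (simp add: divide_le_eq)
    have "real m powr (1/5) / 4 = (real m powr (3/5))\<^sup>2 / (4 * real m)"
    proof -
      have "(real m powr (3/5))\<^sup>2 = real m powr (1/5) * real m powr 1"
        unfolding powr_add[symmetric] by (simp add: power2_eq_square flip: powr_add)
      thus ?thesis using elim by simp
    qed
    also have "\<dots> \<le> (real h)\<^sup>2 / (4 * real m)"
      using h by (intro divide_right_mono power_mono) auto
    finally have 2: "exp (- (real h)\<^sup>2 / (4 * real m)) \<le> exp (- (real m powr (1/5) / 4))"
      by simp
    have "lo m \<le> exp (- (real N ^ 3 / (real m)\<^sup>2)) * (1 - exp (- (real h)\<^sup>2 / (4 * real m)))"
      unfolding lo_def using 1 2 by (intro mult_mono) auto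
    hence "lo m * gauss_main m (k m) \<le> exp (- (real N ^ 3 / (real m)\<^sup>2)) *
        (1 - exp (- (real h)\<^sup>2 / (4 * real m))) * gauss_main m (k m)"
      using gauss_main_pos[OF _ k, of m m] elim by (intro mult_right_mono) auto
    also have "\<dots> \<le> birthday_sum m (k m)"
      unfolding N_def by (rule birthday_sum_ge) (use elim k Nm in \<open>auto simp: N_def\<close>)
    finally show ?case
      using gauss_main_pos[OF _ k, of m m] elim by (simp add: le_divide_eq)
  qed
  moreover have "eventually (\<lambda>m. birthday_sum m (k m) / gauss_main m (k m) \<le> up m) sequentially"
    using eventually_ge_at_top[of 1]
  proof eventually_elim
    case (elim m)
    define d where "d = real m powr (1/3)"
    have d: "d > 0" using elim by (simp add: d_def)
    \<comment> \<open>Writing everything in integer powers of \<open>d\<close> removes the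
      fractional exponents from the algebra.\<close>
    have m: "real m = d ^ 3" using elim by (simp add: d_def powr_powr flip: powr_numeral)
    have e: "real m powr (2/3) = d ^ 2" "real m powr (-2/3) = 1 / d ^ 2" "real m powr (-1/3) = 1 / d"
      using elim by (simp_all add: d_def powr_powr powr_minus_divide flip: powr_numeral)
    have "(2 * (2 * real (k m) - 1) * d + d\<^sup>2) / (4 * real m) =
        r m - real m powr (-2/3) / 2 + real m powr (-1/3) / 4"
      unfolding kr[OF elim] e unfolding m
      using d by (simp add: field_simps power2_eq_square power3_eq_cube)
    hence "birthday_sum m (k m) \<le> up m * gauss_main m (k m)"
      using birthday_sum_le[OF elim k d, of m] by (simp add: up_def d_def)
    thus ?case using gauss_main_pos[OF elim k, of m] by (simp add: divide_le_eq)
  qed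
  ultimately show ?thesis by (rule tendsto_sandwich[OF _ _ lo up])
qed

lemma Phi_tendsto_half:
  assumes "x \<longlonglongrightarrow> 0" "\<And>n. 0 \<le> x n"
  shows "(\<lambda>n. Phi (x n)) \<longlonglongrightarrow> 1 / 2"
proof (rule tendsto_sandwich[where f = "\<lambda>_. 1 / 2" and h = "\<lambda>n. 1 / 2 + x n * std_normal_density 0"])
  have "(\<lambda>n. 1 / 2 + x n * std_normal_density 0) \<longlonglongrightarrow> 1 / 2 + 0 * std_normal_density 0"
    by (intro tendsto_intros assms)
  thus "(\<lambda>n. 1 / 2 + x n * std_normal_density 0) \<longlonglongrightarrow> 1 / 2" by simp
  have "Phi (x n) \<le> 1 / 2 + x n * std_normal_density 0" for n
    using Phi_diff_le[of 0 "x n"] assms(2)[of n] by (simp add: Phi_0)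
  thus "\<forall>\<^sub>F n in sequentially. Phi (x n) \<le> 1 / 2 + x n * std_normal_density 0" by simp
  have "1 / 2 \<le> Phi (x n)" for n
    using Phi_diff_ge[of 0 "x n"] assms(2)[of n]
      mult_nonneg_nonneg[OF assms(2)[of n] normal_density_nonneg[of 0 1 "x n"]]
    by (simp add: Phi_0 del: normal_density_nonneg)
  thus "\<forall>\<^sub>F n in sequentially. 1 / 2 \<le> Phi (x n)" by simp
qed simp

theorem proposition3:
  fixes D :: "real measure" and k :: "nat \<Rightarrow> nat"
  assumes "prob_space D"
    and "sets D = sets borel"
    and "\<And>x. measure D {x} = 0"
    and "\<And>m. k m \<ge> 1"
  shows "((\<lambda>m. real (k m)) \<in> o(\<lambda>m. real m powr (2/3)) \<longrightarrow>
           (\<lambda>m. cycle_prob D m (k m)) \<sim>[at_top]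
           (\<lambda>m. 2 * sqrt (pi / real m) * (1 - Phi ((2 * real (k m) - 1) / sqrt (2 * real m)))))
       \<and> ((\<lambda>m. real (k m)) \<in> o(\<lambda>m. sqrt (real m)) \<longrightarrow>
           (\<lambda>m. cycle_prob D m (k m)) \<sim>[at_top] (\<lambda>m. sqrt (pi / real m)))"
proof -
  let ?Q = "\<lambda>m. 1 - Phi ((2 * real (k m) - 1) / sqrt (2 * real m))"
  have main: "(\<lambda>m. cycle_prob D m (k m)) \<sim>[at_top] (\<lambda>m. 2 * sqrt (pi / real m) * ?Q m)"
    if "(\<lambda>m. real (k m)) \<in> o(\<lambda>m. real m powr (2/3))"
  proof (rule asymp_equivI', rule Lim_transform_eventually)
    show "(\<lambda>m. birthday_sum m (k m) / gauss_main m (k m)) \<longlonglongrightarrow> 1"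
      by (rule birthday_sum_ratio_tendsto) (use assms that in auto)
    show "\<forall>\<^sub>F m in sequentially. birthday_sum m (k m) / gauss_main m (k m) =
        cycle_prob D m (k m) / (2 * sqrt (pi / real m) * ?Q m)"
      using eventually_ge_at_top[of 1]
    proof eventually_elim
      case (elim m)
      \<comment> \<open>The common factor \<open>m\<close> of \<open>birthday_sum\<close> and
        \<open>gauss_main\<close> cancels in the quotient.\<close>
      have "pi * real m = pi / real m * (real m)\<^sup>2"
        using elim by (simp add: power2_eq_square)
      hence "sqrt (pi * real m) = sqrt (pi / real m) * real m"
        by (simp only: real_sqrt_mult real_sqrt_abs abs_of_nat)
      hence "gauss_main m (k m) = real m * (2 * sqrt (pi / real m) * ?Q m)"
        by (simp add: gauss_main_def)
      thus ?case
        using cycle_prob_eq[OF assms(1-3) elim assms(4), of m]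
        by (simp add: birthday_sum_def)
    qed
  qed
  moreover have "(\<lambda>m. cycle_prob D m (k m)) \<sim>[at_top] (\<lambda>m. sqrt (pi / real m))"
    if small: "(\<lambda>m. real (k m)) \<in> o(\<lambda>m. sqrt (real m))"
  proof -
    have "(\<lambda>m::nat. sqrt (real m)) \<in> O(\<lambda>m. real m powr (2/3))" by real_asymp
    with small have "(\<lambda>m. real (k m)) \<in> o(\<lambda>m. real m powr (2/3))"
      by (rule landau_o.small_big_trans)
    note main[OF this]
    also have "(\<lambda>m. 2 * sqrt (pi / real m) * ?Q m) \<sim>[at_top] (\<lambda>m. sqrt (pi / real m))"
    proof (rule asymp_equivI', rule Lim_transform_eventually)
      \<comment> \<open>For \<open>k = o(sqrt m)\<close> the argument of \<open>Phi\<close> tends to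
        0, so \<open>1 - Phi\<close> tends to 1/2 and cancels the factor 2.\<close>
      have "(\<lambda>m. (2 * (real (k m) / sqrt (real m)) - 1 / sqrt (real m)) / sqrt 2) \<longlonglongrightarrow> (2 * 0 - 0) / sqrt 2"
        by (intro tendsto_intros smalloD_tendsto[OF small]) (real_asymp, simp)
      hence "(\<lambda>m. (2 * real (k m) - 1) / sqrt (2 * real m)) \<longlonglongrightarrow> 0"
        by (simp add: real_sqrt_mult diff_divide_distrib mult.commute)
      moreover have "0 \<le> (2 * real (k m) - 1) / sqrt (2 * real m)" for m
        using assms(4)[of m] by simp
      ultimately have "(\<lambda>m. Phi ((2 * real (k m) - 1) / sqrt (2 * real m))) \<longlonglongrightarrow> 1 / 2"
        by (rule Phi_tendsto_half)
      hence "(\<lambda>m. 2 * ?Q m) \<longlonglongrightarrow> 2 * (1 - 1 / 2)" by (intro tendsto_intros)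
      thus "(\<lambda>m. 2 * ?Q m) \<longlonglongrightarrow> 1" by simp
      show "\<forall>\<^sub>F m in sequentially. 2 * ?Q m = 2 * sqrt (pi / real m) * ?Q m / sqrt (pi / real m)"
        using eventually_ge_at_top[of 1] by eventually_elim simp
    qed
    finally show ?thesis .
  qed
  ultimately show ?thesis by blast
qed

end
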